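(* Let $S$ be a numerical semigroup with multiplicity $e$, let $k$ be a field, let $A=k[[S]]$ with maximal ideal $\mathfrak m$, and let $r$ be the reduction number of $\mathfrak m$. Let $M=S\setminus\{0\}$ and, for $0\le n\le r$, write $$\mathrm{Ap}(nM)=\{\omega_{n,0},\dots,\omega_{n,i},\dots,\omega_{n,e-1}\},$$ indexed so that for each $i$ all the $\omega_{n,i}$ ($0\le n\le r$) lie in the same residue class modulo $e$, and $\omega_{n,0}=ne$. For any $1\le i\le e-1$ consider the ladder of values $W^i=\{\omega_{n,i}\}_{0\le n\le r}$ and define the integers (1) $l_i=l(W^i)$; (2) $d_i=e_{l_i}(W^i)$; (3) $b^i_j=e_{j-1}(W^i)$ and $c^i_j=c_j(W^i)$, for $1\le j\le l_i$. Then there is an isomorphism of graded $F_{\mathfrak m}(t^e)$-modules $$G(\mathfrak m)\cong F_{\mathfrak m}(t^e)\oplus\bigoplus_{i=1}^{e-1}\left(F_{\mathfrak m}(t^e)(-d_i)\oplus\bigoplus_{j=1}^{l_i}\frac{F_{\mathfrak m}(t^e)}{((t^e)^{\ast})^{c^i_j}F_{\mathfrak m}(t^e)}(-b^i_j)\right).$$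
   Context: A numerical semigroup $S$ is a subset of $\mathbb N=\{0,1,2,\dots\}$ closed under addition, containing $0$, with finite complement in $\mathbb N$. It has a unique minimal system of generators $n_1<\dots<n_b$; its multiplicity $e=n_1$ is its least nonzero element. For a field $k$, $A=k[[S]]=k[[t^{n_1},\dots,t^{n_b}]]\subseteq k[[t]]$ is a one-dimensional Cohen-Macaulay local ring with maximal ideal $\mathfrak m=(t^{n_1},\dots,t^{n_b})$. The reduction number $r$ of $\mathfrak m$ is the smallest integer $n\ge 0$ such that $\mathfrak m^{n+1}=t^e\mathfrak m^n$. Put $M=S\setminus\{0\}$, $0M:=S$, and $nM=M+\cdots+M$ ($n$ summands) for $n\ge1$. For an ideal $I$ of $S$ (a nonempty $I\subseteq S$ with $I+S\subseteq I$), $\mathrm{Ap}(I)$ denotes the set of the smallest elements of $I$ in each residue class modulo $e$ (so it has $e$ elements). The tangent cone is $G(\mathfrak m)=\bigoplus_{n\ge0}\mathfrak m^n/\mathfrak m^{n+1}$ (with $\mathfrak m^0=A$), and the fiber cone of $(t^e)$ is $F_{\mathfrak m}(t^e)=\bigoplus_{n\ge0}(t^e)^nA/(t^e)^n\mathfrak m$, which embeds as a graded subring in $G(\mathfrak m)$ via the natural maps (so $G(\mathfrak m)$ is a graded $F_{\mathfrak m}(t^e)$-module). $(t^e)^{\ast}$ denotes the initial form of $t^e$, an element of degree $1$ of $F_{\mathfrak m}(t^e)\subseteq G(\mathfrak m)$. For a graded module $N$, $N(-d)$ is the shift with $N(-d)_n=N_{n-d}$. Ladders: a finite sequence of integers $E=\{a_0,\dots,a_n\}$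 is a ladder if $a_0\le\cdots\le a_n$. A subset $L=\{a_i,\dots,a_{i+k}\}$ with $k\ge1$ is a landing of length $k$ if $a_{i-1}<a_i=\cdots=a_{i+k}<a_{i+k+1}$, where $a_{-1}=-\infty$ and $a_{n+1}=\infty$. Its beginning is the index $s(L)=i$ and its end is the index $e(L)=i+k$. Landings are ordered by $L<L'$ iff $s(L)<s(L')$. Let $l(E)+1$ be the number of landings of $E$, and let $L_0<\cdots<L_{l(E)}$ be all the landings. Define $s_j(E)=s(L_j)$ and $e_j(E)=e(L_j)$ for $0\le j\le l(E)$, and $c_j(E)=s_j(E)-e_{j-1}(E)$ for $1\le j\le l(E)$. *)

theory Defs
  imports
    "HOL-Computational_Algebra.Formal_Power_Series"
    "HOL-Algebra.Module"
    "HOL-Algebra.QuotRing"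
    "HOL-Algebra.Ideal_Product"
begin

section \<open>Numerical semigroups\<close>

definition numerical_semigroup :: "nat set \<Rightarrow> bool" where
  "numerical_semigroup S \<longleftrightarrow>
     0 \<in> S \<and> (\<forall>x\<in>S. \<forall>y\<in>S. x + y \<in> S) \<and> finite (UNIV - S)"

definition semigroup_multiplicity :: "nat set \<Rightarrow> nat" where
  "semigroup_multiplicity S = (LEAST n. n \<in> S \<and> n \<noteq> 0)"

text \<open>The set \<open>nM\<close>, where \<open>M = S \<setminus> {0}\<close>, with the convention \<open>0M = S\<close>
  (and not \<open>{0}\<close>).\<close>

definition multiple_of_max :: "nat set \<Rightarrow> nat \<Rightarrow> nat set" where
  "multiple_of_max S n =
     (if n = 0 then S else {(\<Sum>i<n. x i) | x. \<forall>i<n. x i \<in> S - {0}})"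

definition Apery :: "nat \<Rightarrow> nat set \<Rightarrow> nat set" where
  "Apery e I = {x \<in> I. \<forall>y\<in>I. y mod e = x mod e \<longrightarrow> x \<le> y}"

text \<open>\<open>k[[S]]\<close>, as a subring of \<open>k[[t]]\<close>\<close>

definition semigroup_ring :: "nat set \<Rightarrow> 'k::field fps ring" where
  "semigroup_ring S =
     \<lparr>carrier = {f. \<forall>n. fps_nth f n \<noteq> 0 \<longrightarrow> n \<in> S},
      mult = (*), one = 1, zero = 0, add = (+)\<rparr>"


section \<open>Ladders\<close>

text \<open>A ladder \<open>a\<^sub>0 \<le> \<dots> \<le> a\<^sub>n\<close> is a list \<open>E = [a\<^sub>0, \<dots>, a\<^sub>n]\<close> with \<open>sorted E\<close>. A landing is given by
  its beginning \<open>s\<close> and its end \<open>t\<close>; its length \<open>t - s\<close> is positive. The conventions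
  \<open>a\<^sub>-\<^sub>1 = -\<infinity>\<close> and \<open>a\<^sub>n\<^sub>+\<^sub>1 = \<infinity>\<close> become the two disjunctions.\<close>

definition landing :: "int list \<Rightarrow> nat \<Rightarrow> nat \<Rightarrow> bool" where
  "landing E s t \<longleftrightarrow>
     s < t \<and> t < length E \<and> (\<forall>m\<in>{s..t}. E ! m = E ! s) \<and>
     (s = 0 \<or> E ! (s - 1) < E ! s) \<and>
     (Suc t = length E \<or> E ! t < E ! (Suc t))"

text \<open>\<open>ladder_l E + 1\<close> is the number of landings (for a ladder with at least one landing).
  A landing is determined by its beginning, so \<open>ladder_s E j\<close> and \<open>ladder_e E j\<close> belong to
  the landing \<open>L\<^sub>j\<close>. Successive landings satisfy \<open>ladder_e E (j - 1) < ladder_s E j\<close>, so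
  the subtraction in \<open>ladder_c\<close> is not truncated for \<open>1 \<le> j \<le> ladder_l E\<close>.\<close>

definition ladder_l :: "int list \<Rightarrow> nat" where
  "ladder_l E = card {(s, t). landing E s t} - 1"

definition ladder_s :: "int list \<Rightarrow> nat \<Rightarrow> nat" where
  "ladder_s E j = sorted_list_of_set {s. \<exists>t. landing E s t} ! j"

definition ladder_e :: "int list \<Rightarrow> nat \<Rightarrow> nat" where
  "ladder_e E j = (THE t. landing E (ladder_s E j) t)"

definition ladder_c :: "int list \<Rightarrow> nat \<Rightarrow> nat" where
  "ladder_c E j = ladder_s E j - ladder_e E (j - 1)"


section \<open>Graded modules\<close>

text \<open>A graded module carries its homogeneous components, indexed by the integers. The fields
  \<open>mult\<close> and \<open>one\<close> inherited from \<open>module\<close> play no role and are left unspecified where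
  there is no natural choice.\<close>

record ('a, 'b) graded_module = "('a, 'b) module" +
  component :: "int \<Rightarrow> 'b set"

text \<open>\<open>shift N d\<close> is \<open>N(d)\<close>, that is \<open>N(d)\<^sub>n = N\<^sub>n\<^sub>+\<^sub>d\<close>.\<close>

definition shift :: "('a, 'b) graded_module \<Rightarrow> int \<Rightarrow> ('a, 'b) graded_module" where
  "shift N d = N\<lparr>component := (\<lambda>n. component N (n + d))\<rparr>"

definition quotient_module :: "('a, 'b) graded_module \<Rightarrow> 'b set \<Rightarrow> ('a, 'b set) graded_module" where
  "quotient_module N H =
     \<lparr>carrier = a_rcosets\<^bsub>N\<^esub> H, mult = undefined, one = undefined,
      zero = H, add = set_add N,
      smult = (\<lambda>a C. \<Union>x\<in>C. H +>\<^bsub>N\<^esub> (a \<odot>\<^bsub>N\<^esub> x)),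
      component = (\<lambda>n. {H +>\<^bsub>N\<^esub> x | x. x \<in> component N n})\<rparr>"

definition direct_sum2 ::
  "('a, 'b) graded_module \<Rightarrow> ('a, 'c) graded_module \<Rightarrow> ('a, 'b \<times> 'c) graded_module" where
  "direct_sum2 N N' =
     \<lparr>carrier = carrier N \<times> carrier N', mult = undefined, one = undefined,
      zero = (\<zero>\<^bsub>N\<^esub>, \<zero>\<^bsub>N'\<^esub>),
      add = (\<lambda>(x, x') (y, y'). (x \<oplus>\<^bsub>N\<^esub> y, x' \<oplus>\<^bsub>N'\<^esub> y')),
      smult = (\<lambda>a (x, x'). (a \<odot>\<^bsub>N\<^esub> x, a \<odot>\<^bsub>N'\<^esub> x')),
      component = (\<lambda>n. component N n \<times> component N' n)\<rparr>"

text \<open>The direct sum of a family over a finite index set \<open>I\<close> (for infinite \<open>I\<close> this would be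
  a product).\<close>

definition direct_sum ::
  "'i set \<Rightarrow> ('i \<Rightarrow> ('a, 'b) graded_module) \<Rightarrow> ('a, 'i \<Rightarrow> 'b) graded_module" where
  "direct_sum I N =
     \<lparr>carrier = (\<Pi>\<^sub>E i\<in>I. carrier (N i)), mult = undefined, one = undefined,
      zero = (\<lambda>i\<in>I. \<zero>\<^bsub>N i\<^esub>),
      add = (\<lambda>x y. \<lambda>i\<in>I. x i \<oplus>\<^bsub>N i\<^esub> y i),
      smult = (\<lambda>a x. \<lambda>i\<in>I. a \<odot>\<^bsub>N i\<^esub> x i),
      component = (\<lambda>n. \<Pi>\<^sub>E i\<in>I. component (N i) n)\<rparr>"

definition graded_module_iso ::
  "('a, 'r) ring_scheme \<Rightarrow> ('a, 'b) graded_module \<Rightarrow> ('a, 'c) graded_module \<Rightarrow> ('b \<Rightarrow> 'c) \<Rightarrow> bool"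
  where
  "graded_module_iso R N N' \<phi> \<longleftrightarrow>
     bij_betw \<phi> (carrier N) (carrier N') \<and>
     (\<forall>x\<in>carrier N. \<forall>y\<in>carrier N. \<phi> (x \<oplus>\<^bsub>N\<^esub> y) = \<phi> x \<oplus>\<^bsub>N'\<^esub> \<phi> y) \<and>
     (\<forall>a\<in>carrier R. \<forall>x\<in>carrier N. \<phi> (a \<odot>\<^bsub>N\<^esub> x) = a \<odot>\<^bsub>N'\<^esub> \<phi> x) \<and>
     (\<forall>n. \<phi> ` component N n = component N' n)"


section \<open>Tangent cones and fiber cones\<close>

text \<open>The graded ring \<open>\<Oplus>\<^sub>n P\<^sub>n / Q\<^sub>n\<close> for ideals \<open>Q\<^sub>n \<subseteq> P\<^sub>n\<close> of \<open>R\<close> with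
  \<open>P\<^sub>i P\<^sub>j \<subseteq> P\<^sub>i\<^sub>+\<^sub>j\<close> and \<open>P\<^sub>i Q\<^sub>j \<subseteq> Q\<^sub>i\<^sub>+\<^sub>j\<close>. Its elements are the families of cosets
  with finite support, multiplied by convolution from
  \<open>(x + Q\<^sub>i)(y + Q\<^sub>j) = xy + Q\<^sub>i\<^sub>+\<^sub>j\<close>. The sum over \<open>i\<close> in the convolution is a
  \<open>finprod\<close> because \<open>Mod\<close> writes the additive quotient group multiplicatively.\<close>

definition additive_quotient :: "('a, 'r) ring_scheme \<Rightarrow> 'a set \<Rightarrow> 'a set \<Rightarrow> 'a set monoid" where
  "additive_quotient R P Q = (add_monoid R)\<lparr>carrier := P\<rparr> Mod Q"

definition homogeneous :: "('a, 'r) ring_scheme \<Rightarrow> (nat \<Rightarrow> 'a set) \<Rightarrow> nat \<Rightarrow> 'a \<Rightarrow> nat \<Rightarrow> 'a set" where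
  "homogeneous R Q d x = (\<lambda>n. if n = d then Q n +>\<^bsub>R\<^esub> x else Q n)"

definition graded_quotient_ring ::
  "('a, 'r) ring_scheme \<Rightarrow> (nat \<Rightarrow> 'a set) \<Rightarrow> (nat \<Rightarrow> 'a set) \<Rightarrow> (nat \<Rightarrow> 'a set) ring" where
  "graded_quotient_ring R P Q =
     \<lparr>carrier = {f. (\<forall>n. f n \<in> carrier (additive_quotient R (P n) (Q n))) \<and>
                    finite {n. f n \<noteq> Q n}},
      mult = (\<lambda>f g n. finprod (additive_quotient R (P n) (Q n))
                         (\<lambda>i. rcoset_mult R (Q n) (f i) (g (n - i))) {..n}),
      one = homogeneous R Q 0 \<one>\<^bsub>R\<^esub>,
      zero = Q,
      add = (\<lambda>f g n. f n <+>\<^bsub>R\<^esub> g n)\<rparr>"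

definition graded_quotient_component ::
  "('a, 'r) ring_scheme \<Rightarrow> (nat \<Rightarrow> 'a set) \<Rightarrow> (nat \<Rightarrow> 'a set) \<Rightarrow> int \<Rightarrow> (nat \<Rightarrow> 'a set) set" where
  "graded_quotient_component R P Q d =
     {f \<in> carrier (graded_quotient_ring R P Q). \<forall>n. int n \<noteq> d \<longrightarrow> f n = Q n}"

text \<open>Powers of ideals are taken in the monoid \<open>ideals_set R\<close>, so \<open>J\<^sup>0 = R\<close>.\<close>

abbreviation ideal_power :: "('a, 'r) ring_scheme \<Rightarrow> 'a set \<Rightarrow> nat \<Rightarrow> 'a set" where
  "ideal_power R J n \<equiv> J [^]\<^bsub>ideals_set R\<^esub> n"

text \<open>Reduction number of \<open>J\<close> with respect to the principal reduction \<open>(x)\<close>: the least \<open>n\<close> with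
  \<open>J\<^sup>n\<^sup>+\<^sup>1 = x J\<^sup>n\<close>.\<close>

definition reduction_number :: "('a, 'r) ring_scheme \<Rightarrow> 'a set \<Rightarrow> 'a \<Rightarrow> nat" where
  "reduction_number R J x =
     (LEAST n. ideal_power R J (Suc n) = x <#\<^bsub>R\<^esub> ideal_power R J n)"

definition tangent_cone :: "('a, 'r) ring_scheme \<Rightarrow> 'a set \<Rightarrow> (nat \<Rightarrow> 'a set) ring" where
  "tangent_cone R J =
     graded_quotient_ring R (ideal_power R J) (\<lambda>n. ideal_power R J (Suc n))"

text \<open>The fiber cone \<open>\<Oplus>\<^sub>n x\<^sup>nR / x\<^sup>nJ\<close> of the principal ideal \<open>(x)\<close> with respect to \<open>J\<close>, first
  as a ring and then as a graded module over itself.\<close>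

definition fiber_cone :: "('a, 'r) ring_scheme \<Rightarrow> 'a set \<Rightarrow> 'a \<Rightarrow> (nat \<Rightarrow> 'a set) ring" where
  "fiber_cone R J x =
     graded_quotient_ring R (\<lambda>n. (x [^]\<^bsub>R\<^esub> n) <#\<^bsub>R\<^esub> carrier R) (\<lambda>n. (x [^]\<^bsub>R\<^esub> n) <#\<^bsub>R\<^esub> J)"

definition fiber_cone_module ::
  "('a, 'r) ring_scheme \<Rightarrow> 'a set \<Rightarrow> 'a \<Rightarrow> (nat \<Rightarrow> 'a set, nat \<Rightarrow> 'a set) graded_module" where
  "fiber_cone_module R J x =
     (let F = fiber_cone R J x in
      \<lparr>carrier = carrier F, mult = mult F, one = one F, zero = zero F, add = add F,
       smult = mult F,
       component = graded_quotient_component R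
         (\<lambda>n. (x [^]\<^bsub>R\<^esub> n) <#\<^bsub>R\<^esub> carrier R) (\<lambda>n. (x [^]\<^bsub>R\<^esub> n) <#\<^bsub>R\<^esub> J)\<rparr>)"

text \<open>The initial form \<open>x\<^sup>*\<close>, i.e. the class of \<open>x\<close> in degree 1, as an element of the fiber cone.\<close>

definition initial_form :: "('a, 'r) ring_scheme \<Rightarrow> 'a set \<Rightarrow> 'a \<Rightarrow> nat \<Rightarrow> 'a set" where
  "initial_form R J x = homogeneous R (\<lambda>n. (x [^]\<^bsub>R\<^esub> n) <#\<^bsub>R\<^esub> J) 1 x"

text \<open>The natural map from the fiber cone to the tangent cone sends \<open>y + x\<^sup>nJ\<close> to
  \<open>y + J\<^sup>n\<^sup>+\<^sup>1\<close>, which is the sum of the sets \<open>J\<^sup>n\<^sup>+\<^sup>1\<close> and \<open>y + x\<^sup>nJ\<close> when \<open>x \<in> J\<close>.\<close>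

definition fiber_to_tangent ::
  "('a, 'r) ring_scheme \<Rightarrow> 'a set \<Rightarrow> (nat \<Rightarrow> 'a set) \<Rightarrow> nat \<Rightarrow> 'a set" where
  "fiber_to_tangent R J f = (\<lambda>n. ideal_power R J (Suc n) <+>\<^bsub>R\<^esub> f n)"

definition tangent_cone_module ::
  "('a, 'r) ring_scheme \<Rightarrow> 'a set \<Rightarrow> (nat \<Rightarrow> 'a set, nat \<Rightarrow> 'a set) graded_module" where
  "tangent_cone_module R J =
     (let G = tangent_cone R J in
      \<lparr>carrier = carrier G, mult = mult G, one = one G, zero = zero G, add = add G,
       smult = (\<lambda>a g. fiber_to_tangent R J a \<otimes>\<^bsub>G\<^esub> g),
       component = graded_quotient_component R
         (ideal_power R J) (\<lambda>n. ideal_power R J (Suc n))\<rparr>)"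

end

theory Submission
  imports Defs "HOL-Computational_Algebra.Polynomial"
begin

text \<open>The vector space \<open>\<mm>\<^sup>n / \<mm>\<^sup>n\<^sup>+\<^sup>1\<close> has as basis the classes of the monomials \<open>t\<^sup>s\<close> with
  \<open>s \<in> nM \<setminus> (n + 1)M\<close>. Fix a residue class modulo \<open>e\<close> and let \<open>w\<^sub>n\<close> be the least element of \<open>nM\<close>
  in it. Since \<open>e \<in> M\<close>, the elements of \<open>nM\<close> in this class are \<open>w\<^sub>n, w\<^sub>n + e, w\<^sub>n + 2e, \<dots>\<close>, and
  \<open>w\<^sub>n\<^sub>+\<^sub>1\<close> is \<open>w\<^sub>n\<close> or \<open>w\<^sub>n + e\<close>. If it is \<open>w\<^sub>n\<close> (a flat step), the class contributes nothing in
  degree \<open>n\<close>; otherwise it contributes exactly \<open>t\<close> to the power \<open>w\<^sub>n\<close>.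

  The fiber cone is the polynomial ring \<open>k[T]\<close> in the initial form \<open>T\<close> of \<open>t\<^sup>e\<close>. Multiplication by
  \<open>T\<close> adds \<open>e\<close> to the exponent and \<open>1\<close> to the degree. If step \<open>n\<close> is not flat, it therefore sends the
  basis element of degree \<open>n\<close> to the one of degree \<open>n + 1\<close>, or to \<open>0\<close> if step \<open>n + 1\<close> is flat. Hence
  every maximal run \<open>p, \<dots>, q - 1\<close> of steps that are not flat spans a copy of
  \<open>(k[T] / (T\<^sup>q\<^sup>-\<^sup>p))(-p)\<close>. The flat steps of a ladder fill exactly the intervals from the beginning to
  the end of its landings, so the finite runs go from the end of one landing to the beginning of the
  next. No step from \<open>r\<close> on is flat, so the run after the last landing is infinite and
  spans a free module. In the class of \<open>0\<close> one has \<open>w\<^sub>n = ne\<close>, and there is a single run.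

  For the proof that the isomorphism exists, a family of polynomials \<open>y \<gamma>\<close>, one for each run \<open>\<gamma>\<close>, is
  sent to an element of the tangent cone (\<open>tangent_class\<close>) and to an element of the direct sum
  (\<open>summand_classes\<close>). Both maps are linear over \<open>k[T]\<close>, surjective, and surjective in each degree, and both
  forget exactly the coefficients of \<open>y \<gamma>\<close> of degree at least the length of \<open>\<gamma>\<close>
  (\<open>tangent_class_eq_tangent_class_iff\<close>, \<open>summand_classes_eq_iff\<close>). So each factors through the other
  (\<open>graded_module_iso_of_common_presentation\<close>). The arithmetic that makes the runs a generating family
  with these relations is the interpretation of the locale \<open>tangent_generators\<close> in \<open>apery_table\<close>.\<close>

section \<open>Graded quotients of rings of concrete elements\<close>

text \<open>Subrings of a ring type. The semigroup ring has this form, so that its sums, differences and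
  cosets can be computed in the type.\<close>

definition concrete_ring :: "'a::comm_ring_1 set \<Rightarrow> 'a ring" where
  "concrete_ring C = \<lparr>carrier = C, mult = (*), one = 1, zero = 0, add = (+)\<rparr>"

lemma concrete_ring_simps [simp]:
  "carrier (concrete_ring C) = C"
  "x \<otimes>\<^bsub>concrete_ring C\<^esub> y = x * y"
  "\<one>\<^bsub>concrete_ring C\<^esub> = 1"
  "\<zero>\<^bsub>concrete_ring C\<^esub> = 0"
  "x \<oplus>\<^bsub>concrete_ring C\<^esub> y = x + y"
  by (simp_all add: concrete_ring_def)

text \<open>The additive subgroups of a type, without reference to a ring record.\<close>

definition difference_closed :: "'a::ab_group_add set \<Rightarrow> bool" where
  "difference_closed Q \<longleftrightarrow> 0 \<in> Q \<and> (\<forall>x\<in>Q. \<forall>y\<in>Q. x - y \<in> Q)"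

lemma difference_closedD:
  assumes "difference_closed Q"
  shows "0 \<in> Q" "x \<in> Q \<Longrightarrow> y \<in> Q \<Longrightarrow> x - y \<in> Q"
    "x \<in> Q \<Longrightarrow> - x \<in> Q" "x \<in> Q \<Longrightarrow> y \<in> Q \<Longrightarrow> x + y \<in> Q"
proof -
  show 0: "0 \<in> Q" using assms by (simp add: difference_closed_def)
  show diff: "x - y \<in> Q" if "x \<in> Q" "y \<in> Q" for x y
    using assms that by (simp add: difference_closed_def)
  show neg: "- x \<in> Q" if "x \<in> Q" for x using diff[OF 0 that] by simp
  show "x + y \<in> Q" if "x \<in> Q" "y \<in> Q" for x y using diff[OF that(1) neg[OF that(2)]] by simp
qed

lemma difference_closed_sum:
  assumes "difference_closed Q" "\<And>i. i \<in> I \<Longrightarrow> f i \<in> Q"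
  shows "sum f I \<in> Q"
  using assms(2)
  by (induction I rule: infinite_finite_induct) (auto intro: difference_closedD[OF assms(1)])

text \<open>The coset \<open>Q + a\<close> as a membership condition, which is easier to reason with than a set of sums.\<close>

definition residue_class :: "'a::ab_group_add set \<Rightarrow> 'a \<Rightarrow> 'a set" where
  "residue_class Q a = {x. x - a \<in> Q}"

lemma residue_class_iff: "x \<in> residue_class Q a \<longleftrightarrow> x - a \<in> Q"
  by (simp add: residue_class_def)

lemma a_r_coset_concrete: "Q +>\<^bsub>concrete_ring C\<^esub> a = residue_class Q a"
  by (auto simp: a_r_coset_def' residue_class_def algebra_simps)

lemma residue_class_0 [simp]: "residue_class Q 0 = Q"
  by (simp add: residue_class_def)

lemma residue_class_eq_iff:
  assumes "difference_closed Q"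
  shows "residue_class Q a = residue_class Q b \<longleftrightarrow> a - b \<in> Q"
proof
  assume "residue_class Q a = residue_class Q b"
  moreover have "a \<in> residue_class Q a"
    using difference_closedD(1)[OF assms] by (simp add: residue_class_iff)
  ultimately show "a - b \<in> Q" by (simp add: residue_class_iff)
next
  assume ab: "a - b \<in> Q"
  have "x - a \<in> Q \<longleftrightarrow> x - b \<in> Q" for x
    using difference_closedD(4)[OF assms _ ab, of "x - a"] difference_closedD(2)[OF assms _ ab, of "x - b"]
    by auto
  then show "residue_class Q a = residue_class Q b" by (simp add: residue_class_def)
qed

lemma set_add_residue_class:
  assumes "difference_closed Q"
  shows "residue_class Q a <+>\<^bsub>concrete_ring C\<^esub> residue_class Q b = residue_class Q (a + b)"
proof (intro equalityI subsetI)
  fix z assume "z \<in> residue_class Q a <+>\<^bsub>concrete_ring C\<^esub> residue_class Q b"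
  then obtain x y where "z = x + y" "x - a \<in> Q" "y - b \<in> Q"
    by (auto simp: set_add_def' residue_class_iff)
  then show "z \<in> residue_class Q (a + b)"
    using difference_closedD(4)[OF assms, of "x - a" "y - b"]
    by (simp add: residue_class_iff algebra_simps)
next
  fix z assume "z \<in> residue_class Q (a + b)"
  then have "z - b \<in> residue_class Q a" "b \<in> residue_class Q b"
    using difference_closedD(1)[OF assms] by (auto simp: residue_class_iff algebra_simps)
  then show "z \<in> residue_class Q a <+>\<^bsub>concrete_ring C\<^esub> residue_class Q b"
    unfolding set_add_def' by (intro UN_I[of "z - b"] UN_I[of b]) auto
qed

text \<open>These closure conditions make convolution on \<open>\<Oplus>\<^sub>n P\<^sub>n / Q\<^sub>n\<close> independent of the choice of
  representatives. They hold for the filtration that gives the tangent cone and for the one that gives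
  the fiber cone, and inside the locale every graded element is handled through a representing sequence.\<close>

locale graded_ideals =
  fixes C :: "'a::comm_ring_1 set" and P Q :: "nat \<Rightarrow> 'a set"
  assumes P_closed: "difference_closed (P n)"
    and Q_closed: "difference_closed (Q n)"
    and Q_subset_P: "Q n \<subseteq> P n"
    and P_mult_P: "x \<in> P i \<Longrightarrow> y \<in> P j \<Longrightarrow> x * y \<in> P (i + j)"
    and P_mult_Q: "x \<in> P i \<Longrightarrow> y \<in> Q j \<Longrightarrow> x * y \<in> Q (i + j)"
begin

abbreviation G where "G \<equiv> graded_quotient_ring (concrete_ring C) P Q"

definition cls :: "(nat \<Rightarrow> 'a) \<Rightarrow> nat \<Rightarrow> 'a set" where
  "cls a = (\<lambda>n. residue_class (Q n) (a n))"

definition representatives :: "(nat \<Rightarrow> 'a) set" where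
  "representatives = {a. (\<forall>n. a n \<in> P n) \<and> finite {n. a n \<notin> Q n}}"

lemma cls_eq_iff: "cls a = cls b \<longleftrightarrow> (\<forall>n. a n - b n \<in> Q n)"
  by (simp add: cls_def fun_eq_iff residue_class_eq_iff[OF Q_closed])

lemma residue_class_eq_Q_iff: "residue_class (Q n) x = Q n \<longleftrightarrow> x \<in> Q n"
  using residue_class_eq_iff[OF Q_closed, of n x 0] by simp

lemma carrier_additive_quotient:
  "carrier (additive_quotient (concrete_ring C) (P n) (Q n)) = residue_class (Q n) ` P n"
proof -
  have "Q n #>\<^bsub>add_monoid (concrete_ring C)\<lparr>carrier := P n\<rparr>\<^esub> a = residue_class (Q n) a" for a
    using a_r_coset_concrete[of C "Q n" a] by (simp add: a_r_coset_def r_coset_def)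
  then show ?thesis
    by (auto simp: additive_quotient_def FactGroup_def RCOSETS_def)
qed

lemma additive_quotient_add:
  "A \<otimes>\<^bsub>additive_quotient (concrete_ring C) (P n) (Q n)\<^esub> B = A <+>\<^bsub>concrete_ring C\<^esub> B"
  by (simp add: additive_quotient_def FactGroup_def set_add_def set_mult_def)

lemma additive_quotient_one:
  "\<one>\<^bsub>additive_quotient (concrete_ring C) (P n) (Q n)\<^esub> = Q n"
  by (simp add: additive_quotient_def FactGroup_def)

lemma additive_quotient_comm_monoid:
  "comm_monoid (additive_quotient (concrete_ring C) (P n) (Q n))"
proof (rule comm_monoidI)
  let ?G = "additive_quotient (concrete_ring C) (P n) (Q n)"
  note simps = carrier_additive_quotient additive_quotient_add additive_quotient_one
  have 0: "Q n = residue_class (Q n) 0" by simp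
  show "x \<otimes>\<^bsub>?G\<^esub> y \<in> carrier ?G" if "x \<in> carrier ?G" "y \<in> carrier ?G" for x y
    using that difference_closedD(4)[OF P_closed]
    by (auto simp: simps set_add_residue_class[OF Q_closed])
  show "\<one>\<^bsub>?G\<^esub> \<in> carrier ?G"
    unfolding simps using difference_closedD(1)[OF P_closed] using 0 by blast
  show "x \<otimes>\<^bsub>?G\<^esub> y \<otimes>\<^bsub>?G\<^esub> z = x \<otimes>\<^bsub>?G\<^esub> (y \<otimes>\<^bsub>?G\<^esub> z)"
    if "x \<in> carrier ?G" "y \<in> carrier ?G" "z \<in> carrier ?G" for x y z
    using that by (auto simp: simps set_add_residue_class[OF Q_closed] algebra_simps)
  show "\<one>\<^bsub>?G\<^esub> \<otimes>\<^bsub>?G\<^esub> x = x" if "x \<in> carrier ?G" for x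
    using that set_add_residue_class[OF Q_closed[of n], of C 0] by (auto simp: simps)
  show "x \<otimes>\<^bsub>?G\<^esub> y = y \<otimes>\<^bsub>?G\<^esub> x" if "x \<in> carrier ?G" "y \<in> carrier ?G" for x y
    using that by (auto simp: simps set_add_residue_class[OF Q_closed] algebra_simps)
qed

text \<open>The convolution of the graded ring is a product in a quotient group that is written
  multiplicatively; in terms of representatives it is an ordinary sum.\<close>

lemma finprod_additive_quotient:
  fixes m :: nat
  assumes "\<And>i. i \<le> m \<Longrightarrow> x i \<in> P n"
  shows "finprod (additive_quotient (concrete_ring C) (P n) (Q n))
           (\<lambda>i. residue_class (Q n) (x i)) {..m} = residue_class (Q n) (\<Sum>i\<le>m. x i)"
  using assms
proof (induction m)
  interpret comm_monoid "additive_quotient (concrete_ring C) (P n) (Q n)"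
    by (rule additive_quotient_comm_monoid)
  case 0
  then show ?case by (subst finprod_0) (auto simp: carrier_additive_quotient)
next
  interpret comm_monoid "additive_quotient (concrete_ring C) (P n) (Q n)"
    by (rule additive_quotient_comm_monoid)
  case (Suc m)
  then show ?case
    by (subst finprod_Suc)
      (auto simp: carrier_additive_quotient additive_quotient_add set_add_residue_class[OF Q_closed]
        algebra_simps)
qed

text \<open>If \<open>a\<close> and \<open>b\<close> represent the classes of \<open>x\<close> and \<open>y\<close>, then
  \<open>ab - xy = a(b - y) + y(a - x)\<close>, and both summands lie in \<open>Q\<^sub>i\<^sub>+\<^sub>j\<close>.\<close>

lemma rcoset_mult_residue_class:
  assumes "x \<in> P i" "y \<in> P j"
  shows "rcoset_mult (concrete_ring C) (Q (i + j)) (residue_class (Q i) x) (residue_class (Q j) y)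
           = residue_class (Q (i + j)) (x * y)"
proof -
  have "residue_class (Q (i + j)) (a * b) = residue_class (Q (i + j)) (x * y)"
    if "a \<in> residue_class (Q i) x" "b \<in> residue_class (Q j) y" for a b
  proof -
    have a: "a - x \<in> Q i" and b: "b - y \<in> Q j" using that by (auto simp: residue_class_iff)
    have "a = (a - x) + x" by simp
    then have "a \<in> P i"
      using difference_closedD(4)[OF P_closed, of "a - x" i x] a assms(1) Q_subset_P by auto
    then have "a * (b - y) \<in> Q (i + j)" using b P_mult_Q by blast
    moreover have "y * (a - x) \<in> Q (j + i)" using P_mult_Q[OF assms(2) a] .
    ultimately have "a * (b - y) + y * (a - x) \<in> Q (i + j)"
      using difference_closedD(4)[OF Q_closed] by (simp add: add.commute)
    then show ?thesis
      by (simp add: residue_class_eq_iff[OF Q_closed] algebra_simps)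
  qed
  moreover have "x \<in> residue_class (Q i) x" "y \<in> residue_class (Q j) y"
    using difference_closedD(1)[OF Q_closed] by (auto simp: residue_class_iff)
  ultimately show ?thesis
    unfolding rcoset_mult_def a_r_coset_concrete concrete_ring_simps by blast
qed

lemma carrier_graded_quotient: "carrier G = cls ` representatives"
proof (intro equalityI subsetI)
  fix f assume f: "f \<in> carrier G"
  then have "\<forall>n. \<exists>x. x \<in> P n \<and> f n = residue_class (Q n) x"
    by (auto simp: graded_quotient_ring_def carrier_additive_quotient)
  then obtain a where a: "\<And>n. a n \<in> P n" "\<And>n. f n = residue_class (Q n) (a n)" by metis
  have "finite {n. a n \<notin> Q n}"
    using f by (simp add: graded_quotient_ring_def a residue_class_eq_Q_iff)
  with a have "a \<in> representatives" by (simp add: representatives_def)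
  moreover have "f = cls a" by (simp add: cls_def fun_eq_iff a)
  ultimately show "f \<in> cls ` representatives" by blast
next
  fix f assume "f \<in> cls ` representatives"
  then obtain a where "a \<in> representatives" "f = cls a" by blast
  then show "f \<in> carrier G"
    by (simp add: graded_quotient_ring_def carrier_additive_quotient cls_def representatives_def
      residue_class_eq_Q_iff)
qed

lemma add_graded_quotient: "cls a \<oplus>\<^bsub>G\<^esub> cls b = cls (\<lambda>n. a n + b n)"
  by (simp add: graded_quotient_ring_def cls_def set_add_residue_class[OF Q_closed])

lemma homogeneous_eq_cls: "homogeneous (concrete_ring C) Q d x = cls (\<lambda>n. if n = d then x else 0)"
  by (simp add: homogeneous_def cls_def fun_eq_iff a_r_coset_concrete)

lemma mult_graded_quotient:
  assumes "a \<in> representatives" "b \<in> representatives"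
  shows "cls a \<otimes>\<^bsub>G\<^esub> cls b = cls (\<lambda>n. \<Sum>i\<le>n. a i * b (n - i))"
proof
  fix n
  have P: "a i \<in> P i" "b i \<in> P i" for i using assms by (auto simp: representatives_def)
  have eq: "rcoset_mult (concrete_ring C) (Q n) (cls a i) (cls b (n - i))
          = residue_class (Q n) (a i * b (n - i))" if "i \<le> n" for i
    using rcoset_mult_residue_class[OF P(1)[of i] P(2)[of "n - i"]] that by (simp add: cls_def)
  have mem: "a i * b (n - i) \<in> P n" if "i \<le> n" for i
    using P_mult_P[OF P(1)[of i] P(2)[of "n - i"]] that by simp
  interpret comm_monoid "additive_quotient (concrete_ring C) (P n) (Q n)"
    by (rule additive_quotient_comm_monoid)
  have "(cls a \<otimes>\<^bsub>G\<^esub> cls b) n = finprod (additive_quotient (concrete_ring C) (P n) (Q n))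
      (\<lambda>i. rcoset_mult (concrete_ring C) (Q n) (cls a i) (cls b (n - i))) {..n}"
    by (simp add: graded_quotient_ring_def)
  also have "\<dots> = finprod (additive_quotient (concrete_ring C) (P n) (Q n))
      (\<lambda>i. residue_class (Q n) (a i * b (n - i))) {..n}"
    by (rule finprod_cong') (use mem in \<open>auto simp: carrier_additive_quotient eq\<close>)
  also have "\<dots> = cls (\<lambda>n. \<Sum>i\<le>n. a i * b (n - i)) n"
    by (simp add: finprod_additive_quotient[OF mem] cls_def)
  finally show "(cls a \<otimes>\<^bsub>G\<^esub> cls b) n = cls (\<lambda>n. \<Sum>i\<le>n. a i * b (n - i)) n" .
qed

lemma component_graded_quotient:
  "graded_quotient_component (concrete_ring C) P Q d
     = {cls a |a. a \<in> representatives \<and> (\<forall>n. int n \<noteq> d \<longrightarrow> a n \<in> Q n)}"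
proof -
  have "cls a n = Q n \<longleftrightarrow> a n \<in> Q n" for a n
    by (simp add: cls_def residue_class_eq_Q_iff)
  then show ?thesis
    by (auto simp: graded_quotient_component_def carrier_graded_quotient)
qed

end

section \<open>The ideals nM of a numerical semigroup\<close>

locale semigroup_of_multiplicity =
  fixes S :: "nat set" and e :: nat
  assumes semigroup: "numerical_semigroup S"
    and multiplicity: "e = semigroup_multiplicity S"
begin

abbreviation nM :: "nat \<Rightarrow> nat set" where "nM \<equiv> multiple_of_max S"

lemma S_0: "0 \<in> S" and S_add: "x \<in> S \<Longrightarrow> y \<in> S \<Longrightarrow> x + y \<in> S" and S_cofinite: "finite (UNIV - S)"
  using semigroup unfolding numerical_semigroup_def by blast+

lemma S_contains_all_large: "\<exists>N. \<forall>n\<ge>N. n \<in> S"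
  using finite_nat_set_iff_bounded[of "UNIV - S"] S_cofinite
  by (metis DiffI UNIV_I not_le)

lemma e_mem: "e \<in> S" and e_pos: "0 < e" and e_least: "s \<in> S \<Longrightarrow> s \<noteq> 0 \<Longrightarrow> e \<le> s"
proof -
  obtain N where "\<forall>n\<ge>N. n \<in> S" using S_contains_all_large by blast
  then have "\<exists>n. n \<in> S \<and> n \<noteq> 0" by (intro exI[of _ "Suc N"]) auto
  then have "e \<in> S \<and> e \<noteq> 0"
    unfolding multiplicity semigroup_multiplicity_def by (rule LeastI_ex)
  then show "e \<in> S" "0 < e" by auto
  show "s \<in> S \<Longrightarrow> s \<noteq> 0 \<Longrightarrow> e \<le> s"
    unfolding multiplicity semigroup_multiplicity_def by (auto intro: Least_le)
qed

lemma nM_0: "nM 0 = S"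
  by (simp add: multiple_of_max_def)

text \<open>The definition of \<open>nM\<close> treats \<open>0M = S\<close> separately. The recursion also covers that case, because
  \<open>S + M = M\<close>.\<close>

lemma nM_Suc: "nM (Suc n) = {a + b |a b. a \<in> nM n \<and> b \<in> S - {0}}"
proof (cases "n = 0")
  case True
  have "nM (Suc 0) = S - {0}"
    by (auto simp: multiple_of_max_def intro: exI[of _ "\<lambda>_. _"])
  moreover have "{a + b |a b. a \<in> S \<and> b \<in> S - {0}} = S - {0}"
    using S_0 by (auto intro: S_add) (metis add_0)
  ultimately show ?thesis using True by (simp add: nM_0)
next
  case False
  show ?thesis
  proof (intro equalityI subsetI)
    fix s assume "s \<in> nM (Suc n)"
    then obtain x where x: "s = (\<Sum>i<Suc n. x i)" "\<forall>i<Suc n. x i \<in> S - {0}"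
      by (auto simp: multiple_of_max_def)
    then have "(\<Sum>i<n. x i) \<in> nM n" using False by (auto simp: multiple_of_max_def)
    then show "s \<in> {a + b |a b. a \<in> nM n \<and> b \<in> S - {0}}" using x by auto
  next
    fix s assume "s \<in> {a + b |a b. a \<in> nM n \<and> b \<in> S - {0}}"
    then obtain x b where x: "s = (\<Sum>i<n. x i) + b" "\<forall>i<n. x i \<in> S - {0}" "b \<in> S - {0}"
      using False by (auto simp: multiple_of_max_def)
    have "s = (\<Sum>i<Suc n. (x(n := b)) i)" using x by simp
    moreover have "\<forall>i<Suc n. (x(n := b)) i \<in> S - {0}" using x by (auto simp: less_Suc_eq)
    ultimately show "s \<in> nM (Suc n)"
      unfolding multiple_of_max_def if_not_P[OF nat.distinct(2)] by blast
  qed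
qed

lemma nM_SucI: "a \<in> nM n \<Longrightarrow> b \<in> S \<Longrightarrow> b \<noteq> 0 \<Longrightarrow> a + b \<in> nM (Suc n)"
  by (auto simp: nM_Suc)

lemma nM_add_S: "a \<in> nM n \<Longrightarrow> s \<in> S \<Longrightarrow> a + s \<in> nM n"
proof (induction n arbitrary: a)
  case (Suc n)
  then obtain c b where "a = c + b" "c \<in> nM n" "b \<in> S - {0}" by (auto simp: nM_Suc)
  then have "a + s = (c + s) + b" "c + s \<in> nM n" using Suc by auto
  then show ?case using \<open>b \<in> S - {0}\<close> nM_SucI[of "c + s" n b] by (simp add: ac_simps)
qed (auto simp: nM_0 S_add)

lemma nM_Suc_subset: "nM (Suc n) \<subseteq> nM n"
  by (auto simp: nM_Suc intro: nM_add_S)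

lemma nM_add: "a \<in> nM i \<Longrightarrow> b \<in> nM j \<Longrightarrow> a + b \<in> nM (i + j)"
proof (induction j arbitrary: b)
  case 0
  then show ?case by (simp add: nM_0 nM_add_S)
next
  case (Suc j)
  then obtain c d where "b = c + d" "c \<in> nM j" "d \<in> S - {0}" by (auto simp: nM_Suc)
  then have "a + b = (a + c) + d" "a + c \<in> nM (i + j)" using Suc by auto
  then show ?case using \<open>d \<in> S - {0}\<close> nM_SucI[of "a + c" "i + j" d] by (simp add: ac_simps)
qed

lemma nM_ge: "s \<in> nM n \<Longrightarrow> n * e \<le> s"
proof (induction n arbitrary: s)
  case (Suc n)
  then obtain c b where cb: "s = c + b" "c \<in> nM n" "b \<in> S" "b \<noteq> 0" by (auto simp: nM_Suc)
  then show ?case using Suc.IH[of c] e_least[of b] by simp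
qed simp

lemma nM_add_e: "s \<in> nM n \<Longrightarrow> s + e \<in> nM (Suc n)"
  using e_mem e_pos by (auto simp: nM_Suc)

lemma nM_add_multiple_e: "s \<in> nM n \<Longrightarrow> s + k * e \<in> nM (n + k)"
proof (induction k)
  case (Suc k)
  then show ?case using nM_add_e[of "s + k * e" "n + k"] by (simp add: algebra_simps)
qed simp

lemma nM_add_multiple_e_same: "s \<in> nM n \<Longrightarrow> s + k * e \<in> nM n"
proof (induction k)
  case (Suc k)
  then show ?case using nM_add_S[of "s + k * e" n e] e_mem by (simp add: algebra_simps)
qed simp

text \<open>Here \<open>i\<close> is any representative of a residue class, while the index \<open>i\<close> in \<open>\<omega>\<^sub>n\<^sub>,\<^sub>i\<close> only numbers the
  classes.\<close>

definition apery_value :: "nat \<Rightarrow> nat \<Rightarrow> nat" where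
  "apery_value n i = (LEAST s. s \<in> nM n \<and> s mod e = i mod e)"

lemma nM_meets_class: "\<exists>s. s \<in> nM n \<and> s mod e = i mod e"
proof -
  obtain N where N: "\<forall>n\<ge>N. n \<in> S" using S_contains_all_large by blast
  have "i + N * e \<in> S" using N e_pos by (metis le_add2 mult.right_neutral mult_le_mono2 Suc_leI One_nat_def order_trans)
  then have "i + N * e + n * e \<in> nM (0 + n)" by (intro nM_add_multiple_e) (simp add: nM_0)
  then show ?thesis by (intro exI[of _ "i + N * e + n * e"]) simp
qed

lemma apery_value_mem: "apery_value n i \<in> nM n" and apery_value_mod: "apery_value n i mod e = i mod e"
  using LeastI_ex[OF nM_meets_class[of n i]] unfolding apery_value_def by auto

lemma apery_value_le: "s \<in> nM n \<Longrightarrow> s mod e = i mod e \<Longrightarrow> apery_value n i \<le> s"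
  unfolding apery_value_def by (auto intro: Least_le)

text \<open>As \<open>nM\<close> is stable under adding \<open>e\<close>, it contains everything above its least element in a class.\<close>

lemma nM_iff: "s mod e = i mod e \<Longrightarrow> s \<in> nM n \<longleftrightarrow> apery_value n i \<le> s"
proof
  assume mod: "s mod e = i mod e" and le: "apery_value n i \<le> s"
  have "e dvd s - apery_value n i"
    using mod_eq_dvd_iff_nat[OF le, of e] mod apery_value_mod[of n i] by simp
  then obtain k where "s - apery_value n i = e * k" by (rule dvdE)
  then have "s = apery_value n i + k * e" using le by (simp add: mult.commute)
  then show "s \<in> nM n" using nM_add_multiple_e_same[OF apery_value_mem[of n i]] by simp
qed (rule apery_value_le)

lemma apery_value_eqI:
  assumes "s \<in> Apery e (nM n)" "s mod e = i mod e"
  shows "apery_value n i = s"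
proof (rule antisym)
  show "apery_value n i \<le> s" using assms by (auto simp: Apery_def intro: apery_value_le)
  show "s \<le> apery_value n i"
    using assms apery_value_mem[of n i] apery_value_mod[of n i] by (auto simp: Apery_def)
qed

lemma apery_value_mem_Apery: "apery_value n i \<in> Apery e (nM n)"
  using apery_value_mem apery_value_mod apery_value_le by (auto simp: Apery_def)

text \<open>The inclusions \<open>(n + 1)M \<subseteq> nM\<close> and \<open>e + nM \<subseteq> (n + 1)M\<close> bound the step by \<open>0\<close> and \<open>e\<close>, and it is a
  multiple of \<open>e\<close>.\<close>

lemma apery_value_Suc:
  "apery_value (Suc n) i = apery_value n i \<or> apery_value (Suc n) i = apery_value n i + e"
proof -
  let ?w = "\<lambda>n. apery_value n i"
  have lower: "?w n \<le> ?w (Suc n)"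
    using apery_value_mem[of "Suc n" i] nM_Suc_subset apery_value_mod
    by (intro apery_value_le) auto
  have upper: "?w (Suc n) \<le> ?w n + e"
    by (intro apery_value_le nM_add_e apery_value_mem) (simp add: apery_value_mod)
  have "e dvd ?w (Suc n) - ?w n"
    using mod_eq_dvd_iff_nat[OF lower, of e] apery_value_mod[of n i] apery_value_mod[of "Suc n" i] by simp
  then obtain k where k: "?w (Suc n) - ?w n = e * k" by (rule dvdE)
  then have "e * k \<le> e * 1" using upper by linarith
  then have "k \<le> 1" using e_pos by (simp only: mult_le_cancel1)
  then have "k = 0 \<or> k = 1" by linarith
  then show ?thesis using k lower by auto
qed

lemma apery_value_diff_le: "n \<le> m \<Longrightarrow> apery_value m i \<le> apery_value n i + (m - n) * e"
  using nM_add_multiple_e[OF apery_value_mem[of n i], of "m - n"]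
  by (intro apery_value_le) (auto simp: apery_value_mod)

text \<open>A class whose least element is the same in \<open>nM\<close> and in \<open>(n + 1)M\<close> lowers the sum over all classes of the
  natural numbers \<open>apery_value n i - n * e\<close>, and no class raises it. Where the sum is smallest, every
  least element therefore moves by \<open>e\<close>.\<close>

lemma nM_eventually_translates: "\<exists>n. nM (Suc n) = (+) e ` nM n"
proof -
  define f where "f n = (\<Sum>i<e. apery_value n i - n * e)" for n
  obtain n where n: "\<And>m. f n \<le> f m"
    using exists_least_iff[of "\<lambda>y. y \<in> range f"] by (metis rangeE rangeI not_le)
  have ge: "n * e \<le> apery_value n i" for n i by (rule nM_ge[OF apery_value_mem])
  have step: "apery_value (Suc n) i = apery_value n i + e" if "i < e" for i
  proof (rule ccontr)
    assume "apery_value (Suc n) i \<noteq> apery_value n i + e"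
    then have "apery_value (Suc n) i = apery_value n i" using apery_value_Suc by blast
    then have "apery_value (Suc n) i - Suc n * e < apery_value n i - n * e"
      using ge[of "Suc n" i] e_pos by simp
    moreover have "apery_value (Suc n) j - Suc n * e \<le> apery_value n j - n * e" for j
      using apery_value_Suc[of n j] by auto
    ultimately have "f (Suc n) < f n"
      unfolding f_def using that by (intro sum_strict_mono_ex1) auto
    then show False using n[of "Suc n"] by simp
  qed
  have "s \<in> (+) e ` nM n" if s: "s \<in> nM (Suc n)" for s
  proof -
    define i where "i = s mod e"
    have i: "i < e" "s mod e = i mod e" using e_pos by (auto simp: i_def)
    have le: "apery_value n i + e \<le> s" using s nM_iff[OF i(2)] step[OF i(1)] by simp
    have "(s - e) mod e = i mod e" using le i(2) by (metis add_leE le_add_diff_inverse2 mod_add_self2)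
    then have "s - e \<in> nM n" using nM_iff[of "s - e" i n] le by simp
    then show ?thesis using le by (intro image_eqI[of _ _ "s - e"]) auto
  qed
  then have "nM (Suc n) = (+) e ` nM n" using nM_add_e by (auto simp: add.commute)
  then show ?thesis ..
qed

text \<open>Adding \<open>M\<close> to both sides of \<open>(n + 1)M = e + nM\<close> gives the same equation for \<open>n + 1\<close>.\<close>

lemma nM_translates_mono:
  assumes "nM (Suc n) = (+) e ` nM n" "n \<le> m"
  shows "nM (Suc m) = (+) e ` nM m"
  using assms(2)
proof (induction rule: dec_induct)
  case (step m)
  have "nM (Suc (Suc m)) = {e + a + b |a b. a \<in> nM m \<and> b \<in> S - {0}}"
    unfolding nM_Suc[of "Suc m"] step.IH by blast
  also have "\<dots> = (+) e ` nM (Suc m)"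
    unfolding nM_Suc[of m] by (auto simp: add.assoc image_iff)
  finally show ?case .
qed (rule assms(1))

lemma apery_value_step_of_translate:
  assumes "nM (Suc n) = (+) e ` nM n"
  shows "apery_value (Suc n) i = apery_value n i + e"
proof -
  have "apery_value (Suc n) i \<in> (+) e ` nM n" using apery_value_mem[of "Suc n" i] assms by simp
  then obtain s where s: "s \<in> nM n" "apery_value (Suc n) i = e + s" by auto
  then have "s mod e = i mod e" using apery_value_mod[of "Suc n" i] by simp
  then have "apery_value n i \<le> s" using s(1) by (intro apery_value_le)
  then show ?thesis using s(2) apery_value_Suc[of n i] e_pos by linarith
qed

end

section \<open>The semigroup ring and the powers of its maximal ideal\<close>

definition supported :: "nat set \<Rightarrow> 'k::field fps set" where
  "supported T = {f. \<forall>n. fps_nth f n \<noteq> 0 \<longrightarrow> n \<in> T}"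

lemma supportedD: "f \<in> supported T \<Longrightarrow> fps_nth f n \<noteq> 0 \<Longrightarrow> n \<in> T"
  by (simp add: supported_def)

lemma supported_mono: "T \<subseteq> T' \<Longrightarrow> supported T \<subseteq> supported T'"
  by (auto simp: supported_def)

lemma difference_closed_supported: "difference_closed (supported T)"
  by (auto simp: difference_closed_def supported_def) (metis diff_zero)

lemma supported_mult:
  assumes "f \<in> supported T" "g \<in> supported T'" "\<And>s t. s \<in> T \<Longrightarrow> t \<in> T' \<Longrightarrow> s + t \<in> T''"
  shows "f * g \<in> supported T''"
  unfolding supported_def
proof (intro CollectI allI impI)
  fix n assume "fps_nth (f * g) n \<noteq> 0"
  then obtain i where "i \<in> {0..n}" "fps_nth f i * fps_nth g (n - i) \<noteq> 0"
    unfolding fps_mult_nth by (meson sum.neutral)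
  then show "n \<in> T''"
    using assms(3)[of i "n - i"] supportedD[OF assms(1)] supportedD[OF assms(2)] by auto
qed

lemma monomial_supported_iff:
  "fps_const c * fps_X ^ n \<in> supported T \<longleftrightarrow> c = 0 \<or> n \<in> T"
  by (auto simp: supported_def fps_mult_left_const_nth fps_X_power_iff split: if_splits)

lemma X_power_supported_iff: "(fps_X ^ n :: 'k::field fps) \<in> supported T \<longleftrightarrow> n \<in> T"
  using monomial_supported_iff[of "1::'k" n T] by simp

lemma supported_eq_iff: "(supported T :: 'k::field fps set) = supported T' \<longleftrightarrow> T = T'"
proof
  assume "(supported T :: 'k fps set) = supported T'"
  then have "n \<in> T \<longleftrightarrow> n \<in> T'" for n
    using X_power_supported_iff[where 'k='k, of n T] X_power_supported_iff[where 'k='k, of n T'] by blast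
  then show "T = T'" by blast
qed simp

lemma X_power_mult_supported: "(*) (fps_X ^ a) ` supported T = supported ((+) a ` T)"
proof (intro equalityI subsetI)
  fix f :: "'a fps" assume "f \<in> (*) (fps_X ^ a) ` supported T"
  then show "f \<in> supported ((+) a ` T)"
    by (auto simp: X_power_supported_iff intro!: supported_mult[of _ "{a}" _ T])
next
  fix f :: "'a fps" assume f: "f \<in> supported ((+) a ` T)"
  have "f = fps_X ^ a * fps_shift a f"
  proof (rule fps_ext)
    fix n
    have "fps_nth f n = 0" if "n < a" using supportedD[OF f, of n] that by auto
    then show "fps_nth f n = fps_nth (fps_X ^ a * fps_shift a f) n"
      by (simp add: fps_X_power_mult_nth)
  qed
  moreover have "fps_shift a f \<in> supported T"
    unfolding supported_def
  proof (intro CollectI allI impI)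
    fix n assume "fps_nth (fps_shift a f) n \<noteq> 0"
    then have "n + a \<in> (+) a ` T" using supportedD[OF f, of "n + a"] by simp
    then show "n \<in> T" by (auto simp: add.commute)
  qed
  ultimately show "f \<in> (*) (fps_X ^ a) ` supported T" by (rule image_eqI)
qed

lemma semigroup_ring_eq: "semigroup_ring S = concrete_ring (supported S)"
  by (simp add: semigroup_ring_def concrete_ring_def supported_def)

context semigroup_of_multiplicity
begin

abbreviation A :: "'k::field fps ring" where "A \<equiv> concrete_ring (supported S)"

lemma supported_S_mult: "f \<in> supported S \<Longrightarrow> g \<in> supported S \<Longrightarrow> f * g \<in> supported S"
  by (erule (1) supported_mult) (rule S_add)

lemma one_supported_S: "1 \<in> supported S"
  using X_power_supported_iff[of 0 S] S_0 by simp

lemma cring_A: "cring (A :: 'k::field fps ring)"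
proof (rule cringI)
  note closed = difference_closedD[OF difference_closed_supported]
  show "abelian_group (A :: 'k fps ring)"
  proof (rule abelian_groupI)
    show "\<exists>y\<in>carrier A. y \<oplus>\<^bsub>A\<^esub> x = \<zero>\<^bsub>A\<^esub>" if "x \<in> carrier A" for x :: "'k fps"
      using that closed(3) by (intro bexI[of _ "- x"]) auto
  qed (auto intro: closed simp: algebra_simps)
  show "comm_monoid (A :: 'k fps ring)"
    by (rule comm_monoidI) (auto simp: algebra_simps one_supported_S supported_S_mult)
qed (simp add: algebra_simps)

lemma a_inv_A: "x \<in> supported S \<Longrightarrow> \<ominus>\<^bsub>A\<^esub> x = - x"
proof -
  interpret cring A by (rule cring_A)
  show "x \<in> supported S \<Longrightarrow> \<ominus>\<^bsub>A\<^esub> x = - x"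
    using minus_equality[of "- x" x] difference_closedD(3)[OF difference_closed_supported, of x] by simp
qed

lemma ideal_supported:
  assumes "T \<subseteq> S" "\<And>t s. t \<in> T \<Longrightarrow> s \<in> S \<Longrightarrow> t + s \<in> T"
  shows "ideal (supported T) (A :: 'k::field fps ring)"
proof (rule idealI)
  note closed = difference_closedD[OF difference_closed_supported]
  show "ring (A :: 'k fps ring)" using cring_A by (rule cring.axioms)
  show "subgroup (supported T) (add_monoid (A :: 'k fps ring))"
  proof
    show "supported T \<subseteq> carrier (add_monoid A)" using supported_mono[OF assms(1)] by simp
    show "inv\<^bsub>add_monoid A\<^esub> x \<in> supported T" if x: "x \<in> supported T" for x :: "'k fps"
    proof -
      have "x \<in> supported S" using x supported_mono[OF assms(1)] by blast
      then have "inv\<^bsub>add_monoid A\<^esub> x = - x" using a_inv_A[of x] by (simp add: a_inv_def)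
      then show ?thesis using closed(3) x by simp
    qed
  qed (auto intro: closed)
  show "x \<otimes>\<^bsub>A\<^esub> a \<in> supported T" "a \<otimes>\<^bsub>A\<^esub> x \<in> supported T"
    if "a \<in> supported T" "x \<in> carrier A" for a x :: "'k fps"
    using that supported_mult[of a T x S T] assms(2) by (auto simp: mult.commute)
qed

text \<open>The recursion for the coefficients of the inverse expresses the coefficient at \<open>n > 0\<close> through
  products of a coefficient of \<open>f\<close> at \<open>i\<close> and one of the inverse at \<open>n - i\<close>; if one of these does not
  vanish, then \<open>n = i + (n - i)\<close> is a sum of two elements of \<open>S\<close>.\<close>

lemma inverse_supported:
  assumes f: "f \<in> supported S" "fps_nth f 0 \<noteq> 0"
  shows "inverse f \<in> supported S"
proof -
  have "n \<in> S" if "fps_nth (inverse f) n \<noteq> 0" for n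
    using that
  proof (induction n rule: less_induct)
    case (less n)
    show ?case
    proof (cases "n = 0")
      case False
      have "fps_nth f 0 * fps_nth (inverse f) n + (\<Sum>i=1..n. fps_nth f i * fps_nth (inverse f) (n - i))
          = fps_nth (f * inverse f) n"
        by (simp add: fps_mult_nth sum.atLeast_Suc_atMost)
      also have "\<dots> = 0" using False inverse_mult_eq_1'[OF f(2)] by simp
      finally have "(\<Sum>i=1..n. fps_nth f i * fps_nth (inverse f) (n - i)) \<noteq> 0"
        using less.prems f(2) by (metis add.right_neutral mult_eq_0_iff)
      then obtain i where i: "i \<in> {1..n}" "fps_nth f i * fps_nth (inverse f) (n - i) \<noteq> 0"
        by (meson sum.neutral)
      then have "i \<in> S" "n - i \<in> S"
        using supportedD[OF f(1), of i] less.IH[of "n - i"] by auto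
      then show ?thesis using S_add[of i "n - i"] i(1) by simp
    qed (simp add: S_0)
  qed
  then show ?thesis by (simp add: supported_def)
qed

text \<open>Elements with nonzero constant term are units, so every proper ideal lies in \<open>supported (S - {0})\<close>.\<close>

lemma maximal_ideal_eq:
  fixes \<mm> :: "'k::field fps set"
  assumes "maximalideal \<mm> A"
  shows "\<mm> = supported (S - {0})"
proof -
  interpret maximalideal \<mm> A by (rule assms)
  have const_0: "fps_nth f 0 = 0" if f: "f \<in> \<mm>" for f
  proof (rule ccontr)
    assume nz: "fps_nth f 0 \<noteq> 0"
    have fS: "f \<in> supported S" using a_subset f by auto
    have "inverse f * f \<in> \<mm>" using I_l_closed[OF f, of "inverse f"] inverse_supported[OF fS nz] by simp
    then have one: "1 \<in> \<mm>" using inverse_mult_eq_1[OF nz] by simp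
    have "\<mm> = carrier A"
      using I_l_closed[OF one] a_subset by auto
    then show False using I_notcarr by simp
  qed
  have sub: "\<mm> \<subseteq> supported (S - {0})"
  proof
    fix f assume f: "f \<in> \<mm>"
    then have "f \<in> supported S" using a_subset by auto
    then show "f \<in> supported (S - {0})"
      using const_0[OF f] by (auto simp: supported_def intro: gr0I)
  qed
  have 1: "ideal (supported (S - {0}) :: 'k fps set) A" by (rule ideal_supported) (auto intro: S_add)
  have 2: "supported (S - {0}) \<subseteq> carrier (A :: 'k fps ring)" using supported_mono[of "S - {0}" S] by auto
  have "supported (S - {0}) = \<mm> \<or> supported (S - {0}) = carrier (A :: 'k fps ring)"
    by (rule I_maximal[OF 1 sub 2])
  moreover have "(supported (S - {0}) :: 'k fps set) \<noteq> supported S"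
    using S_0 by (auto simp: supported_eq_iff)
  ultimately show ?thesis by auto
qed

text \<open>A series supported on \<open>(n + 1)M\<close> may have infinitely many terms, but it is the finite sum of
  its parts in the residue classes modulo \<open>e\<close>. The part in the class of \<open>i\<close> is a multiple of
  \<open>t\<^sup>a\<close> as soon as some \<open>a + b\<close> with \<open>a \<in> nM\<close> and \<open>b \<in> M\<close> is the least element of
  \<open>(n + 1)M\<close> in that class.\<close>

lemma ideal_prod_supported:
  "ideal_prod A (supported (nM n)) (supported (S - {0})) = (supported (nM (Suc n)) :: 'k::field fps set)"
proof (intro equalityI subsetI)
  fix f :: "'k fps" assume "f \<in> ideal_prod A (supported (nM n)) (supported (S - {0}))"
  then show "f \<in> supported (nM (Suc n))"
  proof induction
    case (prod i j)
    then show ?case by (auto intro!: supported_mult[of i "nM n" j "S - {0}"] nM_SucI)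
  qed (auto intro: difference_closedD[OF difference_closed_supported])
next
  fix f :: "'k fps" assume f: "f \<in> supported (nM (Suc n))"
  define part where "part i = Abs_fps (\<lambda>s. if s mod e = i then fps_nth f s else 0)" for i
  have "part i \<in> ideal_prod A (supported (nM n)) (supported (S - {0}))" if "i < e" for i
  proof -
    obtain a b where ab: "apery_value (Suc n) i = a + b" "a \<in> nM n" "b \<in> S" "b \<noteq> 0"
      using apery_value_mem[of "Suc n" i] by (auto simp: nM_Suc)
    have mem: "s - a \<in> S - {0} \<and> a \<le> s" if nz: "fps_nth (part i) s \<noteq> 0" for s
    proof -
      have s: "s mod e = i mod e" "s \<in> nM (Suc n)"
        using nz supportedD[OF f, of s] \<open>i < e\<close> by (auto simp: part_def split: if_splits)
      then have le: "a + b \<le> s" using ab(1) by (metis apery_value_le)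
      have "s mod e = (a + b) mod e" using s(1) ab(1) apery_value_mod[of "Suc n" i] by simp
      then have "e dvd s - (a + b)" using mod_eq_dvd_iff_nat[OF le] by simp
      then obtain k where "s - (a + b) = e * k" by (rule dvdE)
      then have "s - a = b + k * e" using le by (simp add: mult.commute)
      moreover have "b + k * e \<in> S"
        using nM_add_multiple_e_same[of b 0 k] ab(3) by (simp add: nM_0)
      ultimately show ?thesis using ab(4) le by simp
    qed
    have "part i \<in> supported ((+) a ` (S - {0}))"
      unfolding supported_def using mem by (auto intro!: image_eqI[of _ "(+) a" "_ - a"])
    then obtain g where g: "part i = fps_X ^ a * g" "g \<in> supported (S - {0})"
      unfolding X_power_mult_supported[symmetric] by blast
    show ?thesis
      using ideal_prod.prod[of "fps_X ^ a" "supported (nM n)" g "supported (S - {0})" A] g ab(2)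
      by (simp add: X_power_supported_iff)
  qed
  moreover have "(\<Sum>i<e. part i) = f"
  proof (rule fps_ext)
    fix s
    have "s mod e < e" using e_pos by simp
    then show "fps_nth (\<Sum>i<e. part i) s = fps_nth f s"
      by (simp add: fps_sum_nth part_def sum.delta')
  qed
  moreover have "(\<Sum>i<m. h i) \<in> ideal_prod A (supported (nM n)) (supported (S - {0}))"
    if "\<And>i. i < m \<Longrightarrow> h i \<in> ideal_prod A (supported (nM n)) (supported (S - {0}))" for m :: nat and h :: "nat \<Rightarrow> 'k fps"
    using that
  proof (induction m)
    case 0
    have "0 \<otimes>\<^bsub>A\<^esub> 0 \<in> ideal_prod A (supported (nM n)) (supported (S - {0}))"
      by (rule ideal_prod.prod) (auto intro: difference_closedD[OF difference_closed_supported])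
    then show ?case by simp
  next
    case (Suc m)
    then have "(\<Sum>i<m. h i) \<oplus>\<^bsub>A\<^esub> h m \<in> ideal_prod A (supported (nM n)) (supported (S - {0}))"
      by (intro ideal_prod.sum) auto
    then show ?case by simp
  qed
  ultimately show "f \<in> ideal_prod A (supported (nM n)) (supported (S - {0}))" by metis
qed

lemma ideal_power_eq:
  "ideal_power A (supported (S - {0})) n = (supported (nM n) :: 'k::field fps set)"
proof (induction n)
  case 0
  then show ?case by (simp add: nat_pow_def ideals_set_def nM_0)
next
  case (Suc n)
  have "ideal_power A (supported (S - {0}) :: 'k fps set) (Suc n)
      = ideal_prod A (ideal_power A (supported (S - {0})) n) (supported (S - {0}))"
    by (simp add: nat_pow_def ideals_set_def)
  also have "\<dots> = supported (nM (Suc n))" by (simp only: Suc.IH ideal_prod_supported)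
  finally show ?case .
qed

lemma X_power_l_coset: "fps_X ^ a <#\<^bsub>A\<^esub> supported T = supported ((+) a ` T)"
  unfolding X_power_mult_supported[symmetric] by (auto simp: l_coset_def)

lemma pow_A: "x [^]\<^bsub>A\<^esub> (n::nat) = x ^ n"
  by (induction n) (simp_all add: nat_pow_def mult.commute)

text \<open>Powers of the maximal ideal are determined by their supports, and multiplication by \<open>t\<^sup>e\<close>
  translates supports by \<open>e\<close>. So the reduction number is the first \<open>n\<close> with \<open>(n + 1)M = e + nM\<close>.\<close>

lemma apery_value_step_reduction_number:
  assumes "reduction_number A (supported (S - {0}) :: 'k::field fps set) (fps_X ^ e) \<le> n"
  shows "apery_value (Suc n) i = apery_value n i + e"
proof -
  have eq: "reduction_number A (supported (S - {0}) :: 'k fps set) (fps_X ^ e)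
      = (LEAST n. nM (Suc n) = (+) e ` nM n)"
    unfolding reduction_number_def by (simp only: ideal_power_eq X_power_l_coset supported_eq_iff)
  have "nM (Suc (LEAST n. nM (Suc n) = (+) e ` nM n)) = (+) e ` nM (LEAST n. nM (Suc n) = (+) e ` nM n)"
    using nM_eventually_translates by (rule LeastI_ex)
  then have "nM (Suc n) = (+) e ` nM n"
    by (rule nM_translates_mono) (use assms in \<open>simp only: eq\<close>)
  then show ?thesis by (rule apery_value_step_of_translate)
qed

end

section \<open>The fiber cone is a polynomial ring\<close>

lemma monomial_mult:
  "(fps_const c * fps_X ^ m) * (fps_const d * fps_X ^ n) = fps_const (c * d :: 'k::field) * fps_X ^ (m + n)"
  by (simp add: power_add fps_const_mult[symmetric] mult.assoc mult.left_commute del: fps_const_mult)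

lemma monomial_nth: "fps_nth (fps_const c * fps_X ^ m) n = (if n = m then c else (0::'k::field))"
  by (simp add: fps_X_power_iff)

lemma ex_poly_with_coeffs:
  assumes "finite {n. f n \<noteq> (0::'a::zero)}"
  shows "\<exists>p. \<forall>n. coeff p n = f n"
proof -
  have "f \<in> {f. \<forall>\<^sub>\<infinity> n. f n = 0}" using assms by (simp add: eventually_cofinite)
  then have "coeff (Abs_poly f) n = f n" for n by (simp add: Abs_poly_inverse)
  then show ?thesis by blast
qed

definition homogeneous_poly :: "int \<Rightarrow> 'a::zero poly \<Rightarrow> bool" where
  "homogeneous_poly d p \<longleftrightarrow> (\<forall>n. coeff p n \<noteq> 0 \<longrightarrow> int n = d)"

lemma fiber_cone_module_simps [simp]:
  "carrier (fiber_cone_module R J x) = carrier (fiber_cone R J x)"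
  "a \<oplus>\<^bsub>fiber_cone_module R J x\<^esub> b = a \<oplus>\<^bsub>fiber_cone R J x\<^esub> b"
  "a \<odot>\<^bsub>fiber_cone_module R J x\<^esub> b = a \<otimes>\<^bsub>fiber_cone R J x\<^esub> b"
  "component (fiber_cone_module R J x) = graded_quotient_component R
         (\<lambda>n. (x [^]\<^bsub>R\<^esub> n) <#\<^bsub>R\<^esub> carrier R) (\<lambda>n. (x [^]\<^bsub>R\<^esub> n) <#\<^bsub>R\<^esub> J)"
  by (simp_all add: fiber_cone_module_def Let_def)

text \<open>The parameter \<open>coefficients\<close> carries no information beyond its type; it ties the locale to the field
  \<open>'k\<close>, which \<open>S\<close> and \<open>e\<close> do not mention.\<close>

locale semigroup_ring_over = semigroup_of_multiplicity +
  fixes coefficients :: "'k::field itself"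
begin

abbreviation maximal_ideal :: "'k fps set" where "maximal_ideal \<equiv> supported (S - {0})"

abbreviation F where "F \<equiv> fiber_cone A maximal_ideal (fps_X ^ e)"
abbreviation FM where "FM \<equiv> fiber_cone_module A maximal_ideal (fps_X ^ e)"

sublocale fiber: graded_ideals "supported S :: 'k fps set"
  "\<lambda>n. supported ((+) (n * e) ` S)" "\<lambda>n. supported ((+) (n * e) ` (S - {0}))"
proof
  show "difference_closed (supported ((+) (n * e) ` S) :: 'k fps set)"
    "difference_closed (supported ((+) (n * e) ` (S - {0})) :: 'k fps set)" for n
    by (rule difference_closed_supported)+
  show "supported ((+) (n * e) ` (S - {0})) \<subseteq> (supported ((+) (n * e) ` S) :: 'k fps set)" for n
    by (rule supported_mono) auto
  have *: "s + t \<in> (+) ((i + j) * e) ` T" if st: "s \<in> (+) (i * e) ` S" "t \<in> (+) (j * e) ` T"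
    and T: "\<And>a b. a \<in> S \<Longrightarrow> b \<in> T \<Longrightarrow> a + b \<in> T" for s t i j T
  proof -
    obtain a b where "s = i * e + a" "a \<in> S" "t = j * e + b" "b \<in> T" using st by auto
    then show ?thesis using T[of a b]
      by (intro image_eqI[of _ _ "a + b"]) (auto simp: algebra_simps)
  qed
  show "f * g \<in> supported ((+) ((i + j) * e) ` S)"
    if "f \<in> supported ((+) (i * e) ` S)" "g \<in> supported ((+) (j * e) ` S)" for f g :: "'k fps" and i j
    using that by (rule supported_mult) (rule *, auto intro: S_add)
  show "f * g \<in> supported ((+) ((i + j) * e) ` (S - {0}))"
    if "f \<in> supported ((+) (i * e) ` S)" "g \<in> supported ((+) (j * e) ` (S - {0}))"
    for f g :: "'k fps" and i j
    using that by (rule supported_mult) (rule *, auto intro: S_add)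
qed

lemma X_e_pow_l_coset:
  "((fps_X ^ e :: 'k fps) [^]\<^bsub>A\<^esub> (n::nat)) <#\<^bsub>A\<^esub> supported T = supported ((+) (n * e) ` T)"
  using X_power_l_coset[where 'a='k, of "n * e" T] by (simp add: pow_A power_mult mult.commute)

lemma fiber_cone_eq: "F = fiber.G"
  by (simp add: fiber_cone_def X_e_pow_l_coset)

text \<open>The isomorphism from the polynomial ring onto the fiber cone. It sends the indeterminate to the
  initial form of \<open>t\<^sup>e\<close>.\<close>

definition fiber_class :: "'k poly \<Rightarrow> nat \<Rightarrow> 'k fps set" where
  "fiber_class p = fiber.cls (\<lambda>n. fps_const (coeff p n) * fps_X ^ (n * e))"

lemma fiber_representative:
  "(\<lambda>n. fps_const (coeff p n) * fps_X ^ (n * e)) \<in> fiber.representatives"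
proof -
  have "finite {n. coeff p n \<noteq> 0}" using MOST_coeff_eq_0[of p] by (simp add: eventually_cofinite)
  then show ?thesis
    using S_0 by (auto simp: fiber.representatives_def monomial_supported_iff elim: rev_finite_subset)
qed

lemma fiber_class_eq_iff [simp]: "fiber_class p = fiber_class q \<longleftrightarrow> p = q"
proof -
  have "fps_const a * fps_X ^ s - fps_const b * fps_X ^ s = fps_const (a - b) * fps_X ^ s"
    for a b :: 'k and s by (simp add: left_diff_distrib flip: fps_const_sub)
  then show ?thesis
    unfolding fiber_class_def fiber.cls_eq_iff by (auto simp: monomial_supported_iff poly_eq_iff)
qed

text \<open>Modulo \<open>t\<^sup>n\<^sup>e\<mm>\<close> only the lowest coefficient of an element of \<open>t\<^sup>n\<^sup>eA\<close> survives.\<close>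

lemma fiber_class_of_representative:
  assumes a: "a \<in> fiber.representatives"
  shows "\<exists>p. fiber.cls a = fiber_class p \<and> (\<forall>n. coeff p n = fps_nth (a n) (n * e))"
proof -
  have aP: "a n \<in> supported ((+) (n * e) ` S)" for n using a by (simp add: fiber.representatives_def)
  have zero: "fps_nth (a n) (n * e) = 0" if "a n \<in> supported ((+) (n * e) ` (S - {0}))" for n
    using supportedD[OF that, of "n * e"] by (cases "fps_nth (a n) (n * e) = 0") auto
  have "finite {n. fps_nth (a n) (n * e) \<noteq> 0}"
    using a zero by (auto simp: fiber.representatives_def elim: rev_finite_subset)
  from ex_poly_with_coeffs[OF this]
  obtain p where p: "\<And>n. coeff p n = fps_nth (a n) (n * e)" by blast
  have "a n - fps_const (coeff p n) * fps_X ^ (n * e) \<in> supported ((+) (n * e) ` (S - {0}))" for n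
    unfolding supported_def
  proof (intro CollectI allI impI)
    fix s assume "fps_nth (a n - fps_const (coeff p n) * fps_X ^ (n * e)) s \<noteq> 0"
    then have "s \<noteq> n * e" "fps_nth (a n) s \<noteq> 0"
      unfolding fps_sub_nth monomial_nth by (auto simp: p split: if_splits)
    then show "s \<in> (+) (n * e) ` (S - {0})" using supportedD[OF aP[of n], of s] by auto
  qed
  then have "fiber.cls a = fiber_class p"
    unfolding fiber_class_def fiber.cls_eq_iff by blast
  with p show ?thesis by blast
qed

lemma carrier_F: "carrier F = range fiber_class"
proof -
  have "fiber.cls a \<in> range fiber_class" if a: "a \<in> fiber.representatives" for a
    using fiber_class_of_representative[OF a] by (metis rangeI)
  moreover have "fiber_class p \<in> fiber.cls ` fiber.representatives" for p
    unfolding fiber_class_def using fiber_representative by (rule imageI)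
  ultimately show ?thesis
    unfolding fiber_cone_eq fiber.carrier_graded_quotient by blast
qed

lemma add_F: "fiber_class p \<oplus>\<^bsub>F\<^esub> fiber_class q = fiber_class (p + q)"
  by (simp add: fiber_cone_eq fiber_class_def fiber.add_graded_quotient ring_distribs
      flip: fps_const_add)

lemma mult_F: "fiber_class p \<otimes>\<^bsub>F\<^esub> fiber_class q = fiber_class (p * q)"
proof -
  have "(\<Sum>i\<le>n. (fps_const (coeff p i) * fps_X ^ (i * e)) * (fps_const (coeff q (n - i)) * fps_X ^ ((n - i) * e)))
      = fps_const (coeff (p * q) n) * fps_X ^ (n * e)" for n
  proof -
    have "(\<Sum>i\<le>n. (fps_const (coeff p i) * fps_X ^ (i * e)) * (fps_const (coeff q (n - i)) * fps_X ^ ((n - i) * e)))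
      = (\<Sum>i\<le>n. fps_const (coeff p i * coeff q (n - i)) * fps_X ^ (n * e))"
      by (intro sum.cong refl) (simp add: monomial_mult flip: add_mult_distrib del: fps_const_mult)
    also have "\<dots> = fps_const (coeff (p * q) n) * fps_X ^ (n * e)"
      by (intro fps_ext) (simp add: fps_sum_nth monomial_nth coeff_mult)
    finally show ?thesis .
  qed
  then show ?thesis
    unfolding fiber_cone_eq fiber_class_def
    by (simp add: fiber.mult_graded_quotient[OF fiber_representative fiber_representative])
qed

lemma component_FM: "component FM d = fiber_class ` {p. homogeneous_poly d p}"
proof -
  have "component FM d = {fiber.cls a |a. a \<in> fiber.representatives \<and>
      (\<forall>n. int n \<noteq> d \<longrightarrow> a n \<in> supported ((+) (n * e) ` (S - {0})))}"
    using fiber.component_graded_quotient[of d] by (simp add: X_e_pow_l_coset)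
  also have "\<dots> = fiber_class ` {p. homogeneous_poly d p}"
  proof (intro equalityI subsetI)
    fix f assume "f \<in> {fiber.cls a |a. a \<in> fiber.representatives \<and>
      (\<forall>n. int n \<noteq> d \<longrightarrow> a n \<in> supported ((+) (n * e) ` (S - {0})))}"
    then obtain a where a: "f = fiber.cls a" "a \<in> fiber.representatives"
      and off: "\<And>n. int n \<noteq> d \<Longrightarrow> a n \<in> supported ((+) (n * e) ` (S - {0}))" by blast
    obtain p where p: "fiber.cls a = fiber_class p" "\<And>n. coeff p n = fps_nth (a n) (n * e)"
      using fiber_class_of_representative[OF a(2)] by blast
    have "homogeneous_poly d p"
      unfolding homogeneous_poly_def p(2) using supportedD[OF off] by fastforce
    then show "f \<in> fiber_class ` {p. homogeneous_poly d p}" using a(1) p(1) by blast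
  next
    fix f assume "f \<in> fiber_class ` {p. homogeneous_poly d p}"
    then obtain p where p: "f = fiber_class p" "homogeneous_poly d p" by blast
    have "fps_const (coeff p n) * fps_X ^ (n * e) \<in> supported ((+) (n * e) ` (S - {0}))"
      if "int n \<noteq> d" for n
      using p(2) that by (auto simp: homogeneous_poly_def monomial_supported_iff)
    then show "f \<in> {fiber.cls a |a. a \<in> fiber.representatives \<and>
      (\<forall>n. int n \<noteq> d \<longrightarrow> a n \<in> supported ((+) (n * e) ` (S - {0})))}"
      using p(1) fiber_representative[of p] unfolding fiber_class_def by blast
  qed
  finally show ?thesis .
qed

lemma one_F: "\<one>\<^bsub>F\<^esub> = fiber_class 1"
proof -
  have "\<one>\<^bsub>F\<^esub> = homogeneous A (\<lambda>n. supported ((+) (n * e) ` (S - {0}))) 0 1"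
    by (simp add: fiber_cone_eq graded_quotient_ring_def)
  then show ?thesis
    by (auto simp: fiber.homogeneous_eq_cls fiber_class_def coeff_1 intro!: arg_cong[of _ _ fiber.cls])
qed

lemma initial_form_eq: "initial_form A maximal_ideal (fps_X ^ e) = fiber_class (monom 1 1)"
  unfolding initial_form_def X_e_pow_l_coset fiber.homogeneous_eq_cls fiber_class_def
  by (auto intro!: arg_cong[of _ _ fiber.cls])

lemma initial_form_pow:
  "initial_form A maximal_ideal (fps_X ^ e) [^]\<^bsub>F\<^esub> (c::nat) = fiber_class (monom 1 c)"
proof (induction c)
  case (Suc c)
  have "initial_form A maximal_ideal (fps_X ^ e) [^]\<^bsub>F\<^esub> Suc c
      = (initial_form A maximal_ideal (fps_X ^ e) [^]\<^bsub>F\<^esub> c) \<otimes>\<^bsub>F\<^esub> initial_form A maximal_ideal (fps_X ^ e)"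
    by (simp add: nat_pow_def)
  then show ?case unfolding Suc.IH by (simp add: initial_form_eq mult_F mult_monom)
qed (simp add: nat_pow_def one_F)

text \<open>The coset of \<open>p\<close> modulo \<open>(T\<^sup>c)\<close>, transported to the fiber cone. A polynomial is determined modulo
  \<open>T\<^sup>c\<close> by its first \<open>c\<close> coefficients.\<close>

definition truncation_class :: "nat \<Rightarrow> 'k poly \<Rightarrow> (nat \<Rightarrow> 'k fps set) set" where
  "truncation_class c p = fiber_class ` {q. \<forall>k<c. coeff q k = coeff p k}"

lemma truncation_class_eq_iff:
  "truncation_class c p = truncation_class c q \<longleftrightarrow> (\<forall>k<c. coeff p k = coeff q k)"
proof
  have "fiber_class p \<in> truncation_class c p" by (auto simp: truncation_class_def)
  moreover assume "truncation_class c p = truncation_class c q"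
  ultimately have "fiber_class p \<in> truncation_class c q" by (simp only:)
  then show "\<forall>k<c. coeff p k = coeff q k" by (auto simp: truncation_class_def)
qed (simp add: truncation_class_def)

lemma PIdl_eq: "PIdl\<^bsub>F\<^esub> (initial_form A maximal_ideal (fps_X ^ e) [^]\<^bsub>F\<^esub> c) = truncation_class c 0"
proof -
  have "PIdl\<^bsub>F\<^esub> (initial_form A maximal_ideal (fps_X ^ e) [^]\<^bsub>F\<^esub> c)
      = {fiber_class p \<otimes>\<^bsub>F\<^esub> fiber_class (monom 1 c) |p. True}"
    unfolding cgenideal_def carrier_F initial_form_pow by blast
  also have "\<dots> = fiber_class ` {q. monom 1 c dvd q}"
    by (auto simp: mult_F dvd_def mult.commute)
  also have "\<dots> = truncation_class c 0"
    by (simp add: truncation_class_def monom_1_dvd_iff')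
  finally show ?thesis .
qed

abbreviation quotient where
  "quotient c \<equiv> quotient_module FM (truncation_class c 0)"

lemma a_r_coset_truncation: "truncation_class c 0 +>\<^bsub>FM\<^esub> fiber_class p = truncation_class c p"
proof -
  have "truncation_class c 0 +>\<^bsub>FM\<^esub> fiber_class p = fiber_class ` {q + p |q. \<forall>k<c. coeff q k = 0}"
    by (auto simp: a_r_coset_def' truncation_class_def add_F)
  also have "{q + p |q. \<forall>k<c. coeff q k = 0} = {q. \<forall>k<c. coeff q k = coeff p k}"
    by (auto intro!: exI[of _ "_ - p"])
  finally show ?thesis by (simp add: truncation_class_def)
qed

lemma carrier_quotient: "carrier (quotient c) = range (truncation_class c)"
proof -
  have "carrier (quotient c) = (\<lambda>x. truncation_class c 0 +>\<^bsub>FM\<^esub> x) ` carrier FM"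
    by (auto simp: quotient_module_def A_RCOSETS_def RCOSETS_def a_r_coset_def)
  then show ?thesis by (simp add: carrier_F image_image a_r_coset_truncation)
qed

lemma add_quotient:
  "truncation_class c p \<oplus>\<^bsub>quotient c\<^esub> truncation_class c q = truncation_class c (p + q)"
proof -
  have "truncation_class c p \<oplus>\<^bsub>quotient c\<^esub> truncation_class c q
      = fiber_class ` {p' + q' |p' q'. (\<forall>k<c. coeff p' k = coeff p k) \<and> (\<forall>k<c. coeff q' k = coeff q k)}"
    unfolding quotient_module_def truncation_class_def by (auto simp: set_add_def' add_F)
  also have "{p' + q' |p' q'. (\<forall>k<c. coeff p' k = coeff p k) \<and> (\<forall>k<c. coeff q' k = coeff q k)}
      = {r. \<forall>k<c. coeff r k = coeff (p + q) k}"
  proof (intro equalityI subsetI)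
    fix r assume "r \<in> {r. \<forall>k<c. coeff r k = coeff (p + q) k}"
    then have "r = (r - q) + q" "\<forall>k<c. coeff (r - q) k = coeff p k" by auto
    then show "r \<in> {p' + q' |p' q'. (\<forall>k<c. coeff p' k = coeff p k) \<and> (\<forall>k<c. coeff q' k = coeff q k)}"
      by blast
  qed auto
  finally show ?thesis by (simp add: truncation_class_def)
qed

lemma smult_quotient:
  "fiber_class p \<odot>\<^bsub>quotient c\<^esub> truncation_class c q = truncation_class c (p * q)"
proof -
  have "fiber_class p \<odot>\<^bsub>quotient c\<^esub> truncation_class c q
      = (\<Union>r\<in>{r. \<forall>k<c. coeff r k = coeff q k}. truncation_class c (p * r))"
    by (simp add: quotient_module_def truncation_class_def[of c q] mult_F a_r_coset_truncation)
  also have "\<dots> = (\<Union>r\<in>{r. \<forall>k<c. coeff r k = coeff q k}. truncation_class c (p * q))"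
    by (intro SUP_cong refl) (auto simp: truncation_class_eq_iff coeff_mult intro!: sum.cong)
  also have "\<dots> = truncation_class c (p * q)" by auto
  finally show ?thesis .
qed

lemma component_quotient:
  "component (quotient c) d = truncation_class c ` {p. homogeneous_poly d p}"
proof -
  have "component (quotient c) d = (\<lambda>x. truncation_class c 0 +>\<^bsub>FM\<^esub> x) ` component FM d"
    by (auto simp: quotient_module_def)
  then show ?thesis by (simp only: component_FM image_image a_r_coset_truncation)
qed

end

section \<open>Ladders\<close>

lemma landingD:
  assumes "landing E s t"
  shows "s < t" "t < length E" "s \<le> m \<Longrightarrow> m \<le> t \<Longrightarrow> E ! m = E ! s"
    "s \<noteq> 0 \<Longrightarrow> E ! (s - 1) < E ! s" "Suc t < length E \<Longrightarrow> E ! t < E ! Suc t"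
proof -
  note * = assms[unfolded landing_def Ball_def atLeastAtMost_iff]
  show "s < t" "t < length E" "s \<le> m \<Longrightarrow> m \<le> t \<Longrightarrow> E ! m = E ! s"
    "s \<noteq> 0 \<Longrightarrow> E ! (s - 1) < E ! s" using * by blast+
  show "E ! t < E ! Suc t" if "Suc t < length E" using * that less_irrefl by metis
qed

lemma landing_end_unique:
  assumes "landing E s t" "landing E s t'"
  shows "t = t'"
proof -
  have False if "landing E s t" "landing E s t'" "t < t'" for t t'
  proof -
    have "E ! Suc t = E ! s" "E ! t = E ! s" "Suc t < length E"
      using landingD(3)[OF that(2), of "Suc t"] landingD(3)[OF that(1), of t]
        landingD(1,2)[OF that(1)] landingD(2)[OF that(2)] that(3) by auto
    then show False using landingD(5)[OF that(1)] by simp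
  qed
  then show ?thesis using assms by (metis linorder_neqE_nat)
qed

lemma landing_end_less_start:
  assumes "landing E s t" "landing E s' t'" "s < s'"
  shows "t < s'"
proof (rule ccontr)
  assume "\<not> t < s'"
  then have "E ! s' = E ! s" "E ! (s' - 1) = E ! s"
    using landingD(3)[OF assms(1), of s'] landingD(3)[OF assms(1), of "s' - 1"] assms(3) by auto
  then show False using landingD(4)[OF assms(2)] assms(3) by simp
qed

text \<open>The indices at which a sorted list takes a given value form an interval. For the value at a flat step
  this interval has at least two elements and is a landing.\<close>

lemma landing_of_flat_step:
  assumes "sorted E" "Suc n < length E" "E ! n = E ! Suc n"
  shows "\<exists>s t. landing E s t \<and> s \<le> n \<and> n < t"
proof -
  define s where "s = (LEAST s. E ! s = E ! n)"
  define B where "B = {t. t < length E \<and> E ! t = E ! n}"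
  define t where "t = Max B"
  have s: "E ! s = E ! n" unfolding s_def by (rule LeastI[of _ n]) simp
  have s_least: "s \<le> m" if "E ! m = E ! n" for m unfolding s_def using that by (rule Least_le)
  have B: "finite B" "Suc n \<in> B" using assms(2,3) by (auto simp: B_def)
  have "t \<in> B" unfolding t_def using B by (intro Max_in) auto
  then have t: "t < length E" "E ! t = E ! n" by (auto simp: B_def)
  have t_max: "m \<le> t" if "m < length E" "E ! m = E ! n" for m
    unfolding t_def using B(1) that by (intro Max_ge) (auto simp: B_def)
  have "s \<le> n" using s_least by simp
  moreover have "n < t" using t_max[OF assms(2)] assms(3) by simp
  moreover have "landing E s t"
    unfolding landing_def
  proof (intro conjI ballI)
    show "s < t" using \<open>s \<le> n\<close> \<open>n < t\<close> by simp
    show "t < length E" by (rule t(1))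
    show "E ! m = E ! s" if "m \<in> {s..t}" for m
      using sorted_nth_mono[OF assms(1), of s m] sorted_nth_mono[OF assms(1), of m t] that s t by auto
    show "s = 0 \<or> E ! (s - 1) < E ! s"
    proof (cases "s = 0")
      case False
      then have "E ! (s - 1) \<noteq> E ! n" using s_least[of "s - 1"] by auto
      then show ?thesis using sorted_nth_mono[OF assms(1), of "s - 1" s] s \<open>s < t\<close> t(1) by auto
    qed simp
    show "Suc t = length E \<or> E ! t < E ! Suc t"
    proof (cases "Suc t = length E")
      case False
      then have "E ! Suc t \<noteq> E ! n" using t_max[of "Suc t"] t(1) by auto
      then show ?thesis using sorted_nth_mono[OF assms(1), of t "Suc t"] t False by auto
    qed simp
  qed
  ultimately show ?thesis by blast
qed

text \<open>The condition on the first step makes the first landing begin at \<open>0\<close>. In particular there is a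
  landing, so \<open>ladder_l E\<close> is not a truncated difference, and no run of steps precedes the first landing.\<close>

locale ladder =
  fixes E :: "int list"
  assumes sorted: "sorted E" and first_step: "Suc 0 < length E" "E ! 0 = E ! Suc 0"
begin

definition starts :: "nat set" where "starts = {s. \<exists>t. landing E s t}"

lemma finite_starts: "finite starts"
  by (rule finite_subset[of _ "{..<length E}"]) (auto simp: starts_def intro: less_trans[OF landingD(1,2)])

lemma starts_0: "0 \<in> starts"
  using landing_of_flat_step[OF sorted first_step] by (auto simp: starts_def)

lemma length_starts: "length (sorted_list_of_set starts) = Suc (ladder_l E)"
proof -
  have "bij_betw fst {(s, t). landing E s t} starts"
    by (auto simp: bij_betw_def inj_on_def starts_def image_iff dest: landing_end_unique)
  then have "card {(s, t). landing E s t} = card starts" by (rule bij_betw_same_card)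
  moreover have "card starts > 0" using finite_starts starts_0 by (auto simp: card_gt_0_iff)
  ultimately show ?thesis by (simp add: ladder_l_def)
qed

lemma ladder_s_less: "i < j \<Longrightarrow> j \<le> ladder_l E \<Longrightarrow> ladder_s E i < ladder_s E j"
  using sorted_wrt_nth_less[OF strict_sorted_list_of_set[of starts], of i j] length_starts
  by (simp add: ladder_s_def starts_def)

lemma starts_eq: "starts = ladder_s E ` {..ladder_l E}"
proof -
  have "starts = set (sorted_list_of_set starts)" using finite_starts by simp
  also have "\<dots> = (\<lambda>j. sorted_list_of_set starts ! j) ` {..<Suc (ladder_l E)}"
    unfolding length_starts[symmetric] set_conv_nth by blast
  finally show ?thesis by (simp add: ladder_s_def starts_def lessThan_Suc_atMost)
qed

lemma landing_ladder: "j \<le> ladder_l E \<Longrightarrow> landing E (ladder_s E j) (ladder_e E j)"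
proof -
  assume "j \<le> ladder_l E"
  then have "ladder_s E j \<in> starts" by (simp add: starts_eq)
  then obtain t where t: "landing E (ladder_s E j) t" by (auto simp: starts_def)
  have "ladder_e E j = t"
    unfolding ladder_e_def
  proof (rule the_equality)
    show "landing E (ladder_s E j) t" by (rule t)
    show "t' = t" if "landing E (ladder_s E j) t'" for t' using that t by (rule landing_end_unique)
  qed
  with t show ?thesis by simp
qed

lemma ladder_s_less_e: "j \<le> ladder_l E \<Longrightarrow> ladder_s E j < ladder_e E j"
  by (rule landingD(1)[OF landing_ladder])

lemma ladder_e_less_s: "i < j \<Longrightarrow> j \<le> ladder_l E \<Longrightarrow> ladder_e E i < ladder_s E j"
  by (rule landing_end_less_start[OF landing_ladder landing_ladder]) (auto intro: ladder_s_less)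

lemma ladder_s_0: "ladder_s E 0 = 0"
proof -
  obtain j where "j \<le> ladder_l E" "0 = ladder_s E j" using starts_0 by (auto simp: starts_eq)
  then show ?thesis using ladder_s_less[of 0 j] by (cases "j = 0") auto
qed

lemma ladder_s_mono: "i \<le> j \<Longrightarrow> j \<le> ladder_l E \<Longrightarrow> ladder_s E i \<le> ladder_s E j"
  using ladder_s_less[of i j] by (cases "i = j") auto

lemma ladder_e_mono: "i \<le> j \<Longrightarrow> j \<le> ladder_l E \<Longrightarrow> ladder_e E i \<le> ladder_e E j"
  using ladder_e_less_s[of i j] ladder_s_less_e[of j] by (cases "i = j") auto

definition flat :: "nat \<Rightarrow> bool" where
  "flat n \<longleftrightarrow> Suc n < length E \<and> E ! n = E ! Suc n"

lemma flat_iff: "flat n \<longleftrightarrow> (\<exists>j\<le>ladder_l E. ladder_s E j \<le> n \<and> n < ladder_e E j)"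
proof
  assume "flat n"
  then obtain s t where st: "landing E s t" "s \<le> n" "n < t"
    using landing_of_flat_step[OF sorted] unfolding flat_def by blast
  then have "s \<in> starts" by (auto simp: starts_def)
  then obtain j where "j \<le> ladder_l E" "s = ladder_s E j" by (auto simp: starts_eq)
  then show "\<exists>j\<le>ladder_l E. ladder_s E j \<le> n \<and> n < ladder_e E j"
    using st landing_end_unique[OF _ landing_ladder, of j t] by auto
next
  assume "\<exists>j\<le>ladder_l E. ladder_s E j \<le> n \<and> n < ladder_e E j"
  then obtain j where j: "j \<le> ladder_l E" "ladder_s E j \<le> n" "n < ladder_e E j" by blast
  then show "flat n"
    using landingD(2)[OF landing_ladder[OF j(1)]] landingD(3)[OF landing_ladder[OF j(1)], of n]
      landingD(3)[OF landing_ladder[OF j(1)], of "Suc n"] by (simp add: flat_def)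
qed

text \<open>For \<open>j \<ge> 1\<close> run \<open>j\<close> lies between the landings \<open>L\<^sub>j\<^sub>-\<^sub>1\<close> and \<open>L\<^sub>j\<close>. The free index \<open>0\<close> is used for the
  unbounded run after the last landing. The runs partition the steps that are not flat
  (\<open>run_not_flat\<close>, \<open>not_flat_run\<close>, \<open>run_unique\<close>).\<close>

definition run :: "nat \<Rightarrow> nat \<Rightarrow> bool" where
  "run j n \<longleftrightarrow> (if j = 0 then ladder_e E (ladder_l E) \<le> n
     else ladder_e E (j - 1) \<le> n \<and> n < ladder_e E (j - 1) + ladder_c E j)"

lemma run_end: "1 \<le> j \<Longrightarrow> j \<le> ladder_l E \<Longrightarrow> ladder_e E (j - 1) + ladder_c E j = ladder_s E j"
  using ladder_e_less_s[of "j - 1" j] by (simp add: ladder_c_def)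

lemma run_end_flat: "1 \<le> j \<Longrightarrow> j \<le> ladder_l E \<Longrightarrow> flat (ladder_e E (j - 1) + ladder_c E j)"
  using run_end[of j] ladder_s_less_e[of j] by (auto simp: flat_iff)

lemma run_not_flat:
  assumes "run j n" "j \<le> ladder_l E"
  shows "\<not> flat n"
proof
  assume "flat n"
  then obtain k where k: "k \<le> ladder_l E" "ladder_s E k \<le> n" "n < ladder_e E k" by (auto simp: flat_iff)
  show False
  proof (cases "j = 0")
    case True
    then show False using assms(1) k ladder_e_mono[of k "ladder_l E"] by (simp add: run_def)
  next
    case False
    then have n: "ladder_e E (j - 1) \<le> n" "n < ladder_s E j"
      using assms run_end[of j] by (auto simp: run_def)
    show False
    proof (cases "k < j")
      case True
      then have "k \<le> j - 1" "j - 1 \<le> ladder_l E" using assms(2) by auto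
      then have "ladder_e E k \<le> ladder_e E (j - 1)" by (rule ladder_e_mono)
      then show False using n k by simp
    next
      case False
      then show False using ladder_s_mono[of j k] n k by auto
    qed
  qed
qed

lemma not_flat_run:
  assumes "\<not> flat n"
  shows "\<exists>j\<le>ladder_l E. run j n"
proof (cases "ladder_e E (ladder_l E) \<le> n")
  case True
  then show ?thesis by (intro exI[of _ 0]) (simp add: run_def)
next
  case False
  \<comment> \<open>The step lies outside all landings, hence in the gap before the first landing that ends after it.\<close>
  define k where "k = (LEAST k. n < ladder_e E k)"
  have k: "n < ladder_e E k" unfolding k_def using False by - (rule LeastI[of _ "ladder_l E"], simp)
  have k_le: "k \<le> ladder_l E" unfolding k_def using False by - (rule Least_le, simp)
  have "n < ladder_s E k" using assms k k_le by (meson flat_iff not_le)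
  moreover from this have "k \<noteq> 0" using ladder_s_0 by (cases k) auto
  moreover from this have "ladder_e E (k - 1) \<le> n"
    using not_less_Least[of "k - 1" "\<lambda>k. n < ladder_e E k"] by (auto simp: k_def[symmetric])
  ultimately have "run k n" using run_end[of k] k_le by (simp add: run_def)
  then show ?thesis using k_le by (intro exI[of _ k] conjI)
qed

lemma run_unique:
  assumes "run i n" "run j n" "i \<le> ladder_l E" "j \<le> ladder_l E"
  shows "i = j"
proof -
  have False if ij: "run i n" "run j n" "i < j" "i \<le> ladder_l E" "j \<le> ladder_l E" for i j
  proof -
    have j: "ladder_e E (j - 1) \<le> n" "n < ladder_s E j"
      using ij run_end[of j] by (auto simp: run_def)
    show False
    proof (cases "i = 0")
      case True
      then show False
        using ij j ladder_s_less_e[of j] ladder_e_mono[of j "ladder_l E"] by (simp add: run_def)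
    next
      case False
      then have "n < ladder_s E i" using ij run_end[of i] by (auto simp: run_def)
      moreover have "i \<le> j - 1" "j - 1 \<le> ladder_l E" using ij by auto
      then have "ladder_e E i \<le> ladder_e E (j - 1)" by (rule ladder_e_mono)
      ultimately show False using j ladder_s_less_e[OF ij(4)] by simp
    qed
  qed
  from this[of i j] this[of j i] show ?thesis using assms by (cases i j rule: linorder_cases) simp_all
qed

end

section \<open>The tangent cone is spanned by monomial generators\<close>

lemma set_add_larger_residue_class:
  assumes "difference_closed Q" "Q' \<subseteq> Q" "0 \<in> Q'"
  shows "Q <+>\<^bsub>concrete_ring C\<^esub> residue_class Q' x = residue_class Q x"
proof (intro equalityI subsetI)
  fix z assume "z \<in> Q <+>\<^bsub>concrete_ring C\<^esub> residue_class Q' x"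
  then obtain q y where "z = q + y" "q \<in> Q" "y - x \<in> Q'" by (auto simp: set_add_def' residue_class_iff)
  then show "z \<in> residue_class Q x"
    using difference_closedD(4)[OF assms(1), of q "y - x"] assms(2)
    by (auto simp: residue_class_iff algebra_simps)
next
  fix z assume "z \<in> residue_class Q x"
  then have "z - x \<in> Q" "x \<in> residue_class Q' x" using assms(3) by (auto simp: residue_class_iff)
  then show "z \<in> Q <+>\<^bsub>concrete_ring C\<^esub> residue_class Q' x"
    unfolding set_add_def' by (intro UN_I[of "z - x"] UN_I[of x]) auto
qed

lemma tangent_cone_module_simps [simp]:
  "carrier (tangent_cone_module R J) = carrier (tangent_cone R J)"
  "a \<oplus>\<^bsub>tangent_cone_module R J\<^esub> b = a \<oplus>\<^bsub>tangent_cone R J\<^esub> b"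
  "a \<odot>\<^bsub>tangent_cone_module R J\<^esub> b = fiber_to_tangent R J a \<otimes>\<^bsub>tangent_cone R J\<^esub> b"
  "component (tangent_cone_module R J) = graded_quotient_component R
         (ideal_power R J) (\<lambda>n. ideal_power R J (Suc n))"
  by (simp_all add: tangent_cone_module_def Let_def)

lemma zero_supported: "0 \<in> supported T"
  by (simp add: supported_def)

context semigroup_ring_over
begin

abbreviation GM where "GM \<equiv> tangent_cone_module A maximal_ideal"

sublocale tangent: graded_ideals "supported S :: 'k fps set"
  "\<lambda>n. supported (nM n)" "\<lambda>n. supported (nM (Suc n))"
proof
  show "difference_closed (supported (nM n) :: 'k fps set)"
    "difference_closed (supported (nM (Suc n)) :: 'k fps set)" for n
    by (rule difference_closed_supported)+
  show "supported (nM (Suc n)) \<subseteq> (supported (nM n) :: 'k fps set)" for n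
    by (rule supported_mono[OF nM_Suc_subset])
  show "f * g \<in> supported (nM (i + j))"
    if "f \<in> supported (nM i)" "g \<in> supported (nM j)" for f g :: "'k fps" and i j
    using that by (rule supported_mult) (rule nM_add)
  show "f * g \<in> supported (nM (Suc (i + j)))"
    if "f \<in> supported (nM i)" "g \<in> supported (nM (Suc j))" for f g :: "'k fps" and i j
    using that by (rule supported_mult) (use nM_add[of _ i _ "Suc j"] in simp)
qed

lemma tangent_cone_eq: "tangent_cone A maximal_ideal = tangent.G"
  unfolding tangent_cone_def ideal_power_eq ..

text \<open>The image of \<open>c t\<^sup>n\<^sup>e\<close> is again represented by \<open>c t\<^sup>n\<^sup>e\<close>, because \<open>ne + M \<subseteq> (n + 1)M\<close>.\<close>

lemma fiber_to_tangent_fiber_class: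
  "fiber_to_tangent A maximal_ideal (fiber_class p)
     = tangent.cls (\<lambda>n. fps_const (coeff p n) * fps_X ^ (n * e))"
proof
  fix n
  have "(+) (n * e) ` (S - {0}) \<subseteq> nM (Suc n)"
  proof
    fix s assume "s \<in> (+) (n * e) ` (S - {0})"
    then obtain b where b: "s = n * e + b" "b \<in> S" "b \<noteq> 0" by auto
    have "n * e \<in> nM n" using nM_add_multiple_e[of 0 0 n] S_0 by (simp add: nM_0)
    then show "s \<in> nM (Suc n)" using nM_SucI b by simp
  qed
  then have "(supported ((+) (n * e) ` (S - {0})) :: 'k fps set) \<subseteq> supported (nM (Suc n))"
    by (rule supported_mono)
  then show "fiber_to_tangent A maximal_ideal (fiber_class p) n
      = tangent.cls (\<lambda>n. fps_const (coeff p n) * fps_X ^ (n * e)) n"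
    unfolding fiber_to_tangent_def fiber_class_def fiber.cls_def tangent.cls_def ideal_power_eq
    by (intro set_add_larger_residue_class) (auto intro: difference_closedD difference_closed_supported)
qed

lemma fiber_tangent_representative:
  "(\<lambda>n. fps_const (coeff p n) * fps_X ^ (n * e)) \<in> tangent.representatives"
proof -
  have "finite {n. coeff p n \<noteq> 0}" using MOST_coeff_eq_0[of p] by (simp add: eventually_cofinite)
  moreover have "n * e \<in> nM n" for n using nM_add_multiple_e[of 0 0 n] S_0 by (simp add: nM_0)
  ultimately show ?thesis
    by (auto simp: tangent.representatives_def monomial_supported_iff elim: rev_finite_subset)
qed

end

text \<open>The generator \<open>\<gamma>\<close> is the monomial with exponent \<open>ex \<gamma>\<close> in degree \<open>deg \<gamma>\<close>, so the power of
  \<open>T\<close> with exponent \<open>n - deg \<gamma>\<close> takes it to exponent \<open>ex \<gamma> + (n - deg \<gamma>) * e\<close> in degree \<open>n\<close>; it is live there if the result is not zero. The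
  assumptions say that in each degree the live generators correspond bijectively to the monomial basis.\<close>

locale tangent_generators = semigroup_ring_over S e coefficients
  for S e and coefficients :: "'k::field itself" +
  fixes \<Gamma> :: "'g set" and deg ex :: "'g \<Rightarrow> nat" and live :: "'g \<Rightarrow> nat \<Rightarrow> bool"
  assumes finite_\<Gamma>: "finite \<Gamma>"
    and live_deg: "\<gamma> \<in> \<Gamma> \<Longrightarrow> live \<gamma> n \<Longrightarrow> deg \<gamma> \<le> n"
    and exponent_mem: "\<gamma> \<in> \<Gamma> \<Longrightarrow> deg \<gamma> \<le> n \<Longrightarrow> ex \<gamma> + (n - deg \<gamma>) * e \<in> nM n"
    and live_iff: "\<gamma> \<in> \<Gamma> \<Longrightarrow> deg \<gamma> \<le> n \<Longrightarrow> live \<gamma> n \<longleftrightarrow> ex \<gamma> + (n - deg \<gamma>) * e \<notin> nM (Suc n)"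
    and live_inj: "\<gamma> \<in> \<Gamma> \<Longrightarrow> \<delta> \<in> \<Gamma> \<Longrightarrow> live \<gamma> n \<Longrightarrow> live \<delta> n \<Longrightarrow>
      ex \<gamma> + (n - deg \<gamma>) * e = ex \<delta> + (n - deg \<delta>) * e \<Longrightarrow> \<gamma> = \<delta>"
    and live_surj: "s \<in> nM n \<Longrightarrow> s \<notin> nM (Suc n) \<Longrightarrow>
      \<exists>\<gamma>\<in>\<Gamma>. live \<gamma> n \<and> s = ex \<gamma> + (n - deg \<gamma>) * e"
begin

abbreviation exponent :: "'g \<Rightarrow> nat \<Rightarrow> nat" where
  "exponent \<gamma> n \<equiv> ex \<gamma> + (n - deg \<gamma>) * e"

text \<open>A lift to \<open>A\<close> of the degree \<open>n\<close> part of \<open>\<Sum>\<^sub>\<gamma> y\<^sub>\<gamma> \<gamma>\<close>. Multiplying \<open>y\<^sub>\<gamma>\<close> by a power of the indeterminate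
  makes degrees absolute and removes the generators of degree larger than \<open>n\<close>.\<close>

definition combination :: "('g \<Rightarrow> 'k poly) \<Rightarrow> nat \<Rightarrow> 'k fps" where
  "combination y n = (\<Sum>\<gamma>\<in>\<Gamma>. fps_const (coeff (monom 1 (deg \<gamma>) * y \<gamma>) n) * fps_X ^ exponent \<gamma> n)"

definition tangent_class :: "('g \<Rightarrow> 'k poly) \<Rightarrow> nat \<Rightarrow> 'k fps set" where
  "tangent_class y = tangent.cls (combination y)"

lemma combination_mem: "combination y n \<in> supported (nM n)"
  unfolding combination_def
  by (rule difference_closed_sum[OF difference_closed_supported])
    (auto simp: monomial_supported_iff coeff_monom_mult intro: exponent_mem)

lemma combination_representative: "combination y \<in> tangent.representatives"
proof -
  have "finite (\<Union>\<gamma>\<in>\<Gamma>. {n. coeff (monom 1 (deg \<gamma>) * y \<gamma>) n \<noteq> 0})"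
    using finite_\<Gamma> MOST_coeff_eq_0 by (auto simp: eventually_cofinite)
  moreover have "{n. combination y n \<notin> supported (nM (Suc n))}
      \<subseteq> (\<Union>\<gamma>\<in>\<Gamma>. {n. coeff (monom 1 (deg \<gamma>) * y \<gamma>) n \<noteq> 0})"
  proof
    fix n assume "n \<in> {n. combination y n \<notin> supported (nM (Suc n))}"
    then have "combination y n \<noteq> 0"
      by (auto simp: zero_supported)
    then obtain \<gamma> where "\<gamma> \<in> \<Gamma>" "coeff (monom 1 (deg \<gamma>) * y \<gamma>) n \<noteq> 0"
      unfolding combination_def by (metis (no_types, lifting) sum.neutral fps_const_0_eq_0 mult_zero_left)
    then show "n \<in> (\<Union>\<gamma>\<in>\<Gamma>. {n. coeff (monom 1 (deg \<gamma>) * y \<gamma>) n \<noteq> 0})" by blast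
  qed
  ultimately show ?thesis
    unfolding tangent.representatives_def using combination_mem finite_subset by blast
qed

text \<open>No other generator can produce this exponent: a live one would coincide with \<open>\<gamma>\<close>, and one that is
  not live has its exponent in \<open>(n + 1)M\<close>.\<close>

lemma combination_nth:
  assumes "\<gamma> \<in> \<Gamma>" "live \<gamma> n"
  shows "fps_nth (combination y n) (exponent \<gamma> n) = coeff (y \<gamma>) (n - deg \<gamma>)"
proof -
  have "fps_nth (fps_const (coeff (monom 1 (deg \<delta>) * y \<delta>) n) * fps_X ^ exponent \<delta> n) (exponent \<gamma> n)
      = (if \<delta> = \<gamma> then coeff (y \<gamma>) (n - deg \<gamma>) else 0)" if "\<delta> \<in> \<Gamma>" for \<delta>
  proof (cases "\<delta> = \<gamma>")
    case True
    then show ?thesis using live_deg[OF assms] unfolding monomial_nth by (simp add: coeff_monom_mult)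
  next
    case False
    have "exponent \<gamma> n \<noteq> exponent \<delta> n" if deg: "deg \<delta> \<le> n"
    proof
      assume eq: "exponent \<gamma> n = exponent \<delta> n"
      then have "live \<delta> n"
        using live_iff[OF \<open>\<delta> \<in> \<Gamma>\<close> deg] live_iff[OF assms(1) live_deg[OF assms]] assms(2) by simp
      then show False using live_inj[OF assms(1) \<open>\<delta> \<in> \<Gamma>\<close> assms(2) _ eq] False by simp
    qed
    then show ?thesis using False unfolding monomial_nth by (simp add: coeff_monom_mult)
  qed
  then have "fps_nth (combination y n) (exponent \<gamma> n)
      = (\<Sum>\<delta>\<in>\<Gamma>. if \<delta> = \<gamma> then coeff (y \<gamma>) (n - deg \<gamma>) else 0)"
    unfolding combination_def fps_sum_nth by (intro sum.cong refl)
  then show ?thesis using finite_\<Gamma> assms(1) by simp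
qed

text \<open>Two elements of \<open>\<mm>\<^sup>n\<close> agree modulo \<open>\<mm>\<^sup>n\<^sup>+\<^sup>1\<close> iff their coefficients at the exponents in
  \<open>nM \<setminus> (n + 1)M\<close> agree, and these are the exponents of the live generators.\<close>

lemma tangent_class_eq_iff:
  assumes "\<And>n. a n \<in> supported (nM n)"
  shows "tangent.cls a = tangent_class y
    \<longleftrightarrow> (\<forall>\<gamma>\<in>\<Gamma>. \<forall>n. live \<gamma> n \<longrightarrow> fps_nth (a n) (exponent \<gamma> n) = coeff (y \<gamma>) (n - deg \<gamma>))"
proof
  assume "tangent.cls a = tangent_class y"
  then have *: "a n - combination y n \<in> supported (nM (Suc n))" for n
    by (simp add: tangent_class_def tangent.cls_eq_iff)
  show "\<forall>\<gamma>\<in>\<Gamma>. \<forall>n. live \<gamma> n \<longrightarrow> fps_nth (a n) (exponent \<gamma> n) = coeff (y \<gamma>) (n - deg \<gamma>)"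
  proof (intro ballI allI impI)
    fix \<gamma> n assume \<gamma>: "\<gamma> \<in> \<Gamma>" "live \<gamma> n"
    then have "exponent \<gamma> n \<notin> nM (Suc n)" using live_iff live_deg by blast
    then have "fps_nth (a n - combination y n) (exponent \<gamma> n) = 0" using supportedD[OF *] by blast
    then show "fps_nth (a n) (exponent \<gamma> n) = coeff (y \<gamma>) (n - deg \<gamma>)"
      by (simp add: combination_nth[OF \<gamma>])
  qed
next
  assume *: "\<forall>\<gamma>\<in>\<Gamma>. \<forall>n. live \<gamma> n \<longrightarrow> fps_nth (a n) (exponent \<gamma> n) = coeff (y \<gamma>) (n - deg \<gamma>)"
  have "a n - combination y n \<in> supported (nM (Suc n))" for n
    unfolding supported_def
  proof (intro CollectI allI impI, rule ccontr)
    fix s assume nz: "fps_nth (a n - combination y n) s \<noteq> 0" and s: "s \<notin> nM (Suc n)"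
    have "a n - combination y n \<in> supported (nM n)"
      by (rule difference_closedD(2)[OF difference_closed_supported assms combination_mem])
    then have "s \<in> nM n" using nz by (rule supportedD)
    then obtain \<gamma> where \<gamma>: "\<gamma> \<in> \<Gamma>" "live \<gamma> n" and eq: "s = exponent \<gamma> n"
      using live_surj[OF _ s] by blast
    show False using nz * \<gamma> unfolding eq fps_sub_nth combination_nth[OF \<gamma>] by simp
  qed
  then show "tangent.cls a = tangent_class y"
    unfolding tangent_class_def tangent.cls_eq_iff by blast
qed

lemma tangent_class_eq_tangent_class_iff:
  "tangent_class x = tangent_class y
    \<longleftrightarrow> (\<forall>\<gamma>\<in>\<Gamma>. \<forall>n. live \<gamma> n \<longrightarrow> coeff (x \<gamma>) (n - deg \<gamma>) = coeff (y \<gamma>) (n - deg \<gamma>))"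
  using tangent_class_eq_iff[of "combination x" y] combination_mem combination_nth
  by (simp add: tangent_class_def[of x])

text \<open>Reading off the coefficients at live exponents gives polynomials, since almost all \<open>a n\<close> lie in
  \<open>\<mm>\<^sup>n\<^sup>+\<^sup>1\<close>. The explicit form of the coefficients shows that homogeneous elements come from homogeneous
  polynomials.\<close>

lemma tangent_class_of_representative:
  assumes a: "a \<in> tangent.representatives"
  shows "\<exists>y. tangent.cls a = tangent_class y \<and> (\<forall>\<gamma>\<in>\<Gamma>. \<forall>k. coeff (y \<gamma>) k =
    (if live \<gamma> (k + deg \<gamma>) then fps_nth (a (k + deg \<gamma>)) (exponent \<gamma> (k + deg \<gamma>)) else 0))"
proof -
  define f where "f \<gamma> k =
    (if live \<gamma> (k + deg \<gamma>) then fps_nth (a (k + deg \<gamma>)) (exponent \<gamma> (k + deg \<gamma>)) else 0)" for \<gamma> k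
  have "\<exists>p. \<forall>k. coeff p k = f \<gamma> k" if \<gamma>: "\<gamma> \<in> \<Gamma>" for \<gamma>
  proof (rule ex_poly_with_coeffs)
    have "k + deg \<gamma> \<in> {n. a n \<notin> supported (nM (Suc n))}" if nz: "f \<gamma> k \<noteq> 0" for k
    proof (rule CollectI, rule notI)
      assume "a (k + deg \<gamma>) \<in> supported (nM (Suc (k + deg \<gamma>)))"
      moreover have live: "live \<gamma> (k + deg \<gamma>)" and "fps_nth (a (k + deg \<gamma>)) (exponent \<gamma> (k + deg \<gamma>)) \<noteq> 0"
        using nz by (auto simp: f_def split: if_splits)
      ultimately have "exponent \<gamma> (k + deg \<gamma>) \<in> nM (Suc (k + deg \<gamma>))" by (blast dest: supportedD)
      then show False using live_iff[OF \<gamma>, of "k + deg \<gamma>"] live by simp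
    qed
    then have "(\<lambda>k. k + deg \<gamma>) ` {k. f \<gamma> k \<noteq> 0} \<subseteq> {n. a n \<notin> supported (nM (Suc n))}" by blast
    moreover have "finite {n. a n \<notin> supported (nM (Suc n))}"
      using a by (simp add: tangent.representatives_def)
    ultimately have "finite ((\<lambda>k. k + deg \<gamma>) ` {k. f \<gamma> k \<noteq> 0})" by (rule finite_subset)
    then show "finite {k. f \<gamma> k \<noteq> 0}" by (rule finite_imageD) (simp add: inj_on_def)
  qed
  then obtain y where y: "\<And>\<gamma> k. \<gamma> \<in> \<Gamma> \<Longrightarrow> coeff (y \<gamma>) k = f \<gamma> k" by metis
  have aP: "a n \<in> supported (nM n)" for n using a by (simp add: tangent.representatives_def)
  have "fps_nth (a n) (exponent \<gamma> n) = coeff (y \<gamma>) (n - deg \<gamma>)" if "\<gamma> \<in> \<Gamma>" "live \<gamma> n" for \<gamma> n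
    using that live_deg[OF that] by (simp add: y f_def)
  then have "tangent.cls a = tangent_class y" unfolding tangent_class_eq_iff[OF aP] by blast
  then show ?thesis using y unfolding f_def by blast
qed

lemma carrier_GM: "carrier GM = range tangent_class"
proof -
  have "tangent.cls a \<in> range tangent_class" if "a \<in> tangent.representatives" for a
    using tangent_class_of_representative[OF that] by blast
  moreover have "tangent_class y \<in> tangent.cls ` tangent.representatives" for y
    unfolding tangent_class_def using combination_representative by (rule imageI)
  ultimately show ?thesis
    unfolding tangent_cone_module_simps tangent_cone_eq tangent.carrier_graded_quotient by blast
qed

lemma add_GM: "tangent_class x \<oplus>\<^bsub>GM\<^esub> tangent_class y = tangent_class (\<lambda>\<gamma>. x \<gamma> + y \<gamma>)"
proof -
  have "combination x n + combination y n = combination (\<lambda>\<gamma>. x \<gamma> + y \<gamma>) n" for n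
    by (simp add: combination_def sum.distrib ring_distribs flip: fps_const_add)
  then show ?thesis
    by (simp add: tangent_cone_eq tangent_class_def tangent.add_graded_quotient)
qed

text \<open>The lifts multiply exactly, even in degrees where generators are not live: the convolution of the
  representatives is the combination with coefficients \<open>p * y \<gamma>\<close>.\<close>

lemma smult_GM: "fiber_class p \<odot>\<^bsub>GM\<^esub> tangent_class y = tangent_class (\<lambda>\<gamma>. p * y \<gamma>)"
proof -
  have "(\<Sum>i\<le>n. (fps_const (coeff p i) * fps_X ^ (i * e)) * combination y (n - i))
      = combination (\<lambda>\<gamma>. p * y \<gamma>) n" for n
  proof -
    define z where "z \<gamma> = monom 1 (deg \<gamma>) * y \<gamma>" for \<gamma>
    have product: "(fps_const (coeff p i) * fps_X ^ (i * e)) * (fps_const (coeff (z \<gamma>) (n - i)) * fps_X ^ exponent \<gamma> (n - i))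
        = fps_const (coeff p i * coeff (z \<gamma>) (n - i)) * fps_X ^ exponent \<gamma> n" if "i \<le> n" for i \<gamma>
    proof (cases "deg \<gamma> \<le> n - i")
      case True
      then have "n - deg \<gamma> = i + (n - i - deg \<gamma>)" using that by simp
      then have "i * e + exponent \<gamma> (n - i) = exponent \<gamma> n" by (simp add: add_mult_distrib)
      then show ?thesis unfolding monomial_mult by simp
    qed (simp add: z_def coeff_monom_mult)
    have "(\<Sum>i\<le>n. (fps_const (coeff p i) * fps_X ^ (i * e)) * combination y (n - i))
        = (\<Sum>i\<le>n. \<Sum>\<gamma>\<in>\<Gamma>. fps_const (coeff p i * coeff (z \<gamma>) (n - i)) * fps_X ^ exponent \<gamma> n)"
      unfolding combination_def z_def[symmetric] sum_distrib_left by (intro sum.cong refl product) simp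
    also have "\<dots> = (\<Sum>\<gamma>\<in>\<Gamma>. \<Sum>i\<le>n. fps_const (coeff p i * coeff (z \<gamma>) (n - i)) * fps_X ^ exponent \<gamma> n)"
      by (rule sum.swap)
    also have "\<dots> = (\<Sum>\<gamma>\<in>\<Gamma>. fps_const (coeff (p * z \<gamma>) n) * fps_X ^ exponent \<gamma> n)"
      by (intro sum.cong refl fps_ext) (simp add: fps_sum_nth monomial_nth coeff_mult)
    also have "\<dots> = combination (\<lambda>\<gamma>. p * y \<gamma>) n"
      by (simp add: combination_def z_def mult.left_commute)
    finally show ?thesis .
  qed
  then show ?thesis
    unfolding tangent_cone_module_simps fiber_to_tangent_fiber_class tangent_cone_eq tangent_class_def
      tangent.mult_graded_quotient[OF fiber_tangent_representative combination_representative]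
    by simp
qed

lemma component_GM:
  "component GM d = tangent_class ` {y. \<forall>\<gamma>\<in>\<Gamma>. homogeneous_poly (d - int (deg \<gamma>)) (y \<gamma>)}"
proof -
  let ?H = "{y :: 'g \<Rightarrow> 'k poly. \<forall>\<gamma>\<in>\<Gamma>. homogeneous_poly (d - int (deg \<gamma>)) (y \<gamma>)}"
  let ?K = "{tangent.cls a |a. a \<in> tangent.representatives \<and>
      (\<forall>n. int n \<noteq> d \<longrightarrow> a n \<in> supported (nM (Suc n)))}"
  have "component GM d = ?K"
    unfolding tangent_cone_module_simps ideal_power_eq by (rule tangent.component_graded_quotient)
  also have "\<dots> = tangent_class ` ?H"
  proof (intro equalityI subsetI)
    fix f assume "f \<in> ?K"
    then obtain a where a: "f = tangent.cls a" "a \<in> tangent.representatives"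
      and off: "\<And>n. int n \<noteq> d \<Longrightarrow> a n \<in> supported (nM (Suc n))" by blast
    obtain y where y: "tangent.cls a = tangent_class y"
      "\<And>\<gamma> k. \<gamma> \<in> \<Gamma> \<Longrightarrow> coeff (y \<gamma>) k =
        (if live \<gamma> (k + deg \<gamma>) then fps_nth (a (k + deg \<gamma>)) (exponent \<gamma> (k + deg \<gamma>)) else 0)"
      using tangent_class_of_representative[OF a(2)] by blast
    have "homogeneous_poly (d - int (deg \<gamma>)) (y \<gamma>)" if \<gamma>: "\<gamma> \<in> \<Gamma>" for \<gamma>
      unfolding homogeneous_poly_def
    proof (intro allI impI, rule ccontr)
      fix k assume nz: "coeff (y \<gamma>) k \<noteq> 0" and "int k \<noteq> d - int (deg \<gamma>)"
      then have "a (k + deg \<gamma>) \<in> supported (nM (Suc (k + deg \<gamma>)))" by (intro off) simp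
      moreover have live: "live \<gamma> (k + deg \<gamma>)" and "fps_nth (a (k + deg \<gamma>)) (exponent \<gamma> (k + deg \<gamma>)) \<noteq> 0"
        using nz by (auto simp: y(2)[OF \<gamma>] split: if_splits)
      ultimately have "exponent \<gamma> (k + deg \<gamma>) \<in> nM (Suc (k + deg \<gamma>))" by (blast dest: supportedD)
      then show False using live_iff[OF \<gamma>, of "k + deg \<gamma>"] live by simp
    qed
    then show "f \<in> tangent_class ` ?H" using a(1) y(1) by blast
  next
    fix f assume "f \<in> tangent_class ` ?H"
    then obtain y where f: "f = tangent_class y"
      and y: "\<And>\<gamma> n. \<gamma> \<in> \<Gamma> \<Longrightarrow> coeff (y \<gamma>) n \<noteq> 0 \<Longrightarrow> int n = d - int (deg \<gamma>)"
      by (auto simp: homogeneous_poly_def)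
    have "combination y n = 0" if "int n \<noteq> d" for n
      unfolding combination_def
    proof (intro sum.neutral ballI)
      fix \<gamma> assume \<gamma>: "\<gamma> \<in> \<Gamma>"
      have "coeff (monom 1 (deg \<gamma>) * y \<gamma>) n = 0"
        using y[OF \<gamma>, of "n - deg \<gamma>"] that
        by (cases "coeff (y \<gamma>) (n - deg \<gamma>) = 0") (auto simp: coeff_monom_mult)
      then show "fps_const (coeff (monom 1 (deg \<gamma>) * y \<gamma>) n) * fps_X ^ exponent \<gamma> n = 0" by simp
    qed
    then have "\<forall>n. int n \<noteq> d \<longrightarrow> combination y n \<in> supported (nM (Suc n))"
      by (simp add: zero_supported)
    then show "f \<in> ?K" using combination_representative f unfolding tangent_class_def by blast
  qed
  finally show ?thesis .
qed

end

section \<open>Ladders of Apery values and generators of the tangent cone\<close>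

locale apery_table = semigroup_ring_over S e coefficients
  for S e and coefficients :: "'k::field itself" +
  fixes r :: nat and \<omega> :: "nat \<Rightarrow> nat \<Rightarrow> nat" and W :: "nat \<Rightarrow> int list"
    and l d :: "nat \<Rightarrow> nat" and b c :: "nat \<Rightarrow> nat \<Rightarrow> nat"
  assumes reduction: "r = reduction_number A maximal_ideal (fps_X ^ e)"
    and apery: "n \<le> r \<Longrightarrow> Apery e (nM n) = \<omega> n ` {0..e - 1}"
    and same_class: "i \<le> e - 1 \<Longrightarrow> n \<le> r \<Longrightarrow> n' \<le> r \<Longrightarrow> \<omega> n i mod e = \<omega> n' i mod e"
    and zero_class: "n \<le> r \<Longrightarrow> \<omega> n 0 = n * e"
    and W: "i \<in> {1..e - 1} \<Longrightarrow> W i = map (\<lambda>n. int (\<omega> n i)) [0..<Suc r]"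
    and l: "i \<in> {1..e - 1} \<Longrightarrow> l i = ladder_l (W i)"
    and d: "i \<in> {1..e - 1} \<Longrightarrow> d i = ladder_e (W i) (l i)"
    and b: "i \<in> {1..e - 1} \<Longrightarrow> j \<in> {1..l i} \<Longrightarrow> b i j = ladder_e (W i) (j - 1)"
    and c: "i \<in> {1..e - 1} \<Longrightarrow> j \<in> {1..l i} \<Longrightarrow> c i j = ladder_c (W i) j"
begin

abbreviation v :: "nat \<Rightarrow> nat \<Rightarrow> nat" where "v i n \<equiv> apery_value n (\<omega> 0 i)"

lemma \<omega>_eq: "i \<le> e - 1 \<Longrightarrow> n \<le> r \<Longrightarrow> \<omega> n i = v i n"
  using apery[of n] same_class[of i n 0] by (intro apery_value_eqI[symmetric]) auto

lemma class_surj: "\<exists>i\<le>e - 1. \<omega> 0 i mod e = s mod e"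
proof -
  have "apery_value 0 s \<in> \<omega> 0 ` {0..e - 1}" using apery_value_mem_Apery[of 0 s] apery[of 0] by simp
  then obtain i where "i \<le> e - 1" "apery_value 0 s = \<omega> 0 i" by auto
  then show ?thesis using apery_value_mod[of 0 s] by auto
qed

text \<open>The \<open>e\<close> indices meet all \<open>e\<close> residue classes.\<close>

lemma class_inj: "i \<le> e - 1 \<Longrightarrow> i' \<le> e - 1 \<Longrightarrow> \<omega> 0 i mod e = \<omega> 0 i' mod e \<Longrightarrow> i = i'"
proof -
  have "(\<lambda>i. \<omega> 0 i mod e) ` {0..e - 1} = {..<e}"
  proof (intro equalityI subsetI)
    fix s assume "s \<in> {..<e}"
    then show "s \<in> (\<lambda>i. \<omega> 0 i mod e) ` {0..e - 1}" using class_surj[of s] by force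
  qed (use e_pos in auto)
  then have "card ((\<lambda>i. \<omega> 0 i mod e) ` {0..e - 1}) = card {0..e - 1}" using e_pos by simp
  then have "inj_on (\<lambda>i. \<omega> 0 i mod e) {0..e - 1}" by (intro eq_card_imp_inj_on) auto
  then show "i \<le> e - 1 \<Longrightarrow> i' \<le> e - 1 \<Longrightarrow> \<omega> 0 i mod e = \<omega> 0 i' mod e \<Longrightarrow> i = i'"
    by (auto dest: inj_onD)
qed

lemma v_0: "v 0 n = n * e"
proof (rule antisym)
  have "n * e \<in> nM n" using nM_add_multiple_e[of 0 0 n] S_0 by (simp add: nM_0)
  then show "v 0 n \<le> n * e" by (rule apery_value_le) (simp add: zero_class)
  show "n * e \<le> v 0 n" by (rule nM_ge[OF apery_value_mem])
qed

lemma v_step: "r \<le> n \<Longrightarrow> v i (Suc n) = v i n + e"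
  using apery_value_step_reduction_number[where 'k='k, of n "\<omega> 0 i"] reduction by simp

text \<open>The class of \<open>i \<noteq> 0\<close> does not contain \<open>0\<close>, so its least element in \<open>S\<close> already lies in \<open>M\<close>.\<close>

lemma v_first_step:
  assumes "i \<in> {1..e - 1}"
  shows "v i (Suc 0) = v i 0"
proof -
  have "\<omega> 0 i mod e \<noteq> \<omega> 0 0 mod e" using class_inj[of i 0] assms by auto
  then have "v i 0 \<noteq> 0" using apery_value_mod[of 0 "\<omega> 0 i"] zero_class[of 0] by (metis le0 mult_zero_left)
  then have "0 + v i 0 \<in> nM (Suc 0)"
    using apery_value_mem[of 0 "\<omega> 0 i"] S_0 by (intro nM_SucI) (auto simp: nM_0)
  then have "v i (Suc 0) \<le> v i 0" by (intro apery_value_le) (auto simp: apery_value_mod)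
  then show ?thesis using apery_value_Suc[of 0 "\<omega> 0 i"] by auto
qed

lemma W_nth: "i \<in> {1..e - 1} \<Longrightarrow> n \<le> r \<Longrightarrow> W i ! n = int (v i n)"
  using \<omega>_eq[of i n] by (simp add: W less_Suc_eq_le del: upt_Suc)

lemma length_W: "i \<in> {1..e - 1} \<Longrightarrow> length (W i) = Suc r"
  by (simp add: W)

lemma ladder_W:
  assumes i: "i \<in> {1..e - 1}"
  shows "ladder (W i)"
proof
  have "r \<noteq> 0" using v_step[of 0 i] v_first_step[OF i] e_pos by auto
  then show "Suc 0 < length (W i)" "W i ! 0 = W i ! Suc 0"
    using v_first_step[OF i] by (auto simp: length_W[OF i] W_nth[OF i])
  show "sorted (W i)"
    unfolding sorted_iff_nth_Suc
  proof (intro allI impI)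
    fix n assume "Suc n < length (W i)"
    then show "W i ! n \<le> W i ! Suc n"
      using apery_value_Suc[of n "\<omega> 0 i"] by (auto simp: length_W[OF i] W_nth[OF i])
  qed
qed

lemma flat_iff_v:
  assumes i: "i \<in> {1..e - 1}"
  shows "ladder.flat (W i) n \<longleftrightarrow> v i (Suc n) = v i n"
proof (cases "Suc n \<le> r")
  case True
  then show ?thesis
    by (simp add: ladder.flat_def[OF ladder_W[OF i]] length_W[OF i] W_nth[OF i] eq_commute)
next
  case False
  then show ?thesis using v_step[of n i] e_pos
    by (simp add: ladder.flat_def[OF ladder_W[OF i]] length_W[OF i])
qed

text \<open>The pair \<open>(i, j)\<close> stands for run \<open>j\<close> of the ladder \<open>W i\<close>, with \<open>j = 0\<close> for the unbounded one. The
  class of \<open>0\<close> has no flat steps and only the run \<open>(0, 0)\<close>, starting in degree \<open>0\<close>.\<close>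

definition \<Gamma> :: "(nat \<times> nat) set" where
  "\<Gamma> = insert (0, 0) (SIGMA i:{1..e - 1}. {..l i})"

definition deg :: "nat \<times> nat \<Rightarrow> nat" where
  "deg = (\<lambda>(i, j). if i = 0 then 0 else if j = 0 then d i else b i j)"

definition ex :: "nat \<times> nat \<Rightarrow> nat" where
  "ex \<gamma> = v (fst \<gamma>) (deg \<gamma>)"

definition live :: "nat \<times> nat \<Rightarrow> nat \<Rightarrow> bool" where
  "live = (\<lambda>(i, j) n. deg (i, j) \<le> n \<and> (i = 0 \<or> j = 0 \<or> n < deg (i, j) + c i j))"

lemma \<Gamma>_cases:
  assumes "\<gamma> \<in> \<Gamma>"
  obtains "\<gamma> = (0, 0)" | i j where "\<gamma> = (i, j)" "i \<in> {1..e - 1}" "j \<le> l i"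
  using assms by (auto simp: \<Gamma>_def)

lemma live_iff_run:
  assumes "i \<in> {1..e - 1}" "j \<le> l i"
  shows "live (i, j) n \<longleftrightarrow> ladder.run (W i) j n"
  using assms by (auto simp: live_def deg_def ladder.run_def[OF ladder_W] l[symmetric] d b c)

lemma live_step:
  assumes "\<gamma> \<in> \<Gamma>" "live \<gamma> n"
  shows "v (fst \<gamma>) (Suc n) = v (fst \<gamma>) n + e"
  using assms(1)
proof (cases rule: \<Gamma>_cases)
  case 1
  then show ?thesis by (simp add: v_0)
next
  case (2 i j)
  then have "\<not> ladder.flat (W i) n"
    using assms(2) live_iff_run[of i j n] ladder.run_not_flat[OF ladder_W, of i j n] l by auto
  then show ?thesis using 2 flat_iff_v[of i n] apery_value_Suc[of n "\<omega> 0 i"] by auto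
qed

lemma live_exponent:
  assumes "\<gamma> \<in> \<Gamma>" "live \<gamma> n"
  shows "ex \<gamma> + (n - deg \<gamma>) * e = v (fst \<gamma>) n"
proof -
  have "deg \<gamma> \<le> n" using assms(2) by (auto simp: live_def split: prod.splits)
  then show ?thesis using assms(2)
  proof (induction n rule: dec_induct)
    case base
    then show ?case by (simp add: ex_def)
  next
    case (step n)
    then have "live \<gamma> n" by (auto simp: live_def split: prod.splits)
    then show ?case using step live_step[OF assms(1), of n] by (simp add: Suc_diff_le)
  qed
qed

lemma exponent_mod: "(ex \<gamma> + (n - deg \<gamma>) * e) mod e = \<omega> 0 (fst \<gamma>) mod e"
  by (simp add: ex_def apery_value_mod)

text \<open>Step \<open>s = deg \<gamma> + c i j\<close> after the run is flat. The exponent of \<open>\<gamma>\<close> grows by \<open>e\<close> there while the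
  least element of the class does not. As the latter grows by at most \<open>e\<close> in each step, it stays
  strictly behind.\<close>

lemma dead_exponent:
  assumes "\<gamma> \<in> \<Gamma>" "deg \<gamma> \<le> n" "\<not> live \<gamma> n"
  shows "ex \<gamma> + (n - deg \<gamma>) * e \<in> nM (Suc n)"
  using assms(1)
proof (cases rule: \<Gamma>_cases)
  case 1
  then show ?thesis using assms(2,3) by (simp add: live_def)
next
  case (2 i j)
  define s where "s = deg \<gamma> + c i j"
  have j: "1 \<le> j" and s: "s \<le> n" using assms(2,3) 2 by (auto simp: live_def s_def)
  have "ladder.flat (W i) s"
    using ladder.run_end_flat[OF ladder_W, of i j] j 2 b[of i j] c[of i j] l[of i]
    by (auto simp: s_def deg_def)
  then have flat: "v i (Suc s) = v i s" using flat_iff_v 2 by simp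
  have "v i (Suc n) \<le> v i (Suc s) + (n - s) * e"
    using apery_value_diff_le[of "Suc s" "Suc n" "\<omega> 0 i"] s by simp
  also have "\<dots> \<le> v i (deg \<gamma>) + (s - deg \<gamma>) * e + (n - s) * e"
    using apery_value_diff_le[of "deg \<gamma>" s "\<omega> 0 i"] flat by (simp add: s_def)
  also have "\<dots> = ex \<gamma> + (n - deg \<gamma>) * e"
    using s 2 by (simp add: ex_def s_def flip: add_mult_distrib)
  finally show ?thesis using nM_iff[OF exponent_mod, of \<gamma> n "Suc n"] 2 by simp
qed

sublocale tangent_generators S e coefficients \<Gamma> deg ex live
proof
  show "finite \<Gamma>" by (simp add: \<Gamma>_def)
  show live_deg: "deg \<gamma> \<le> n" if "live \<gamma> n" for \<gamma> n
    using that by (auto simp: live_def split: prod.splits)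
  show "ex \<gamma> + (n - deg \<gamma>) * e \<in> nM n" if "deg \<gamma> \<le> n" for \<gamma> n
    using nM_iff[OF exponent_mod, of \<gamma> n n] apery_value_diff_le[OF that, of "\<omega> 0 (fst \<gamma>)"]
    by (simp add: ex_def)
  have live_not: "ex \<gamma> + (n - deg \<gamma>) * e \<notin> nM (Suc n)" if "\<gamma> \<in> \<Gamma>" "live \<gamma> n" for \<gamma> n
    using nM_iff[OF exponent_mod, of \<gamma> n "Suc n"] live_exponent[OF that] live_step[OF that] e_pos by simp
  show "live \<gamma> n \<longleftrightarrow> ex \<gamma> + (n - deg \<gamma>) * e \<notin> nM (Suc n)" if "\<gamma> \<in> \<Gamma>" "deg \<gamma> \<le> n" for \<gamma> n
    using live_not dead_exponent that by blast
  show "\<gamma> = \<delta>" if \<gamma>: "\<gamma> \<in> \<Gamma>" and \<delta>: "\<delta> \<in> \<Gamma>" and live: "live \<gamma> n" "live \<delta> n"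
    and eq: "ex \<gamma> + (n - deg \<gamma>) * e = ex \<delta> + (n - deg \<delta>) * e" for \<gamma> \<delta> n
  proof -
    have "fst \<gamma> \<le> e - 1" "fst \<delta> \<le> e - 1" using \<gamma> \<delta> by (auto simp: \<Gamma>_def)
    moreover have "\<omega> 0 (fst \<gamma>) mod e = \<omega> 0 (fst \<delta>) mod e"
      using exponent_mod[of \<gamma> n] exponent_mod[of \<delta> n] eq by simp
    ultimately have fst: "fst \<gamma> = fst \<delta>" by (rule class_inj)
    show ?thesis using \<gamma>
    proof (cases rule: \<Gamma>_cases)
      case 1
      then show ?thesis using \<delta> fst by (auto simp: \<Gamma>_def)
    next
      case (2 i j)
      then obtain j' where j': "\<delta> = (i, j')" "j' \<le> l i" using \<delta> fst by (cases \<delta>) (auto simp: \<Gamma>_def)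
      have "ladder.run (W i) j n" "ladder.run (W i) j' n"
        using live 2 j' live_iff_run[of i] by auto
      then show ?thesis using ladder.run_unique[OF ladder_W, of i j n j'] 2 j' l[of i] by auto
    qed
  qed
  show "\<exists>\<gamma>\<in>\<Gamma>. live \<gamma> n \<and> s = ex \<gamma> + (n - deg \<gamma>) * e" if s: "s \<in> nM n" "s \<notin> nM (Suc n)" for s n
  proof -
    obtain i where i: "i \<le> e - 1" "\<omega> 0 i mod e = s mod e" using class_surj by blast
    have le: "v i n \<le> s" and less: "s < v i (Suc n)"
      using s nM_iff[OF i(2)[symmetric], of n] nM_iff[OF i(2)[symmetric], of "Suc n"] by auto
    have "e dvd s - v i n" using mod_eq_dvd_iff_nat[OF le, of e] i(2) by (simp add: apery_value_mod)
    moreover have "s - v i n < e" using le less apery_value_Suc[of n "\<omega> 0 i"] by auto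
    ultimately have eq: "s = v i n" using le nat_dvd_not_less[of "s - v i n" e] by (cases "s - v i n = 0") auto
    obtain j where j: "(i, j) \<in> \<Gamma>" "live (i, j) n"
    proof (cases "i = 0")
      case True
      then show thesis using that[of 0] by (simp add: \<Gamma>_def live_def deg_def)
    next
      case False
      then have i': "i \<in> {1..e - 1}" using i by auto
      then have "\<not> ladder.flat (W i) n" using flat_iff_v le less by auto
      then obtain j where "j \<le> l i" "ladder.run (W i) j n"
        using ladder.not_flat_run[OF ladder_W[OF i']] l[OF i'] by auto
      then show thesis using that[of j] i' live_iff_run by (auto simp: \<Gamma>_def)
    qed
    then show ?thesis using live_exponent[of "(i, j)" n] eq by (intro bexI[of _ "(i, j)"]) auto
  qed
qed

end

section \<open>The decomposition\<close>

text \<open>A map that sends \<open>\<alpha> x\<close> to \<open>\<beta> x\<close> is well defined and injective because \<open>\<alpha>\<close> and \<open>\<beta>\<close> have the same fibres.\<close>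

lemma graded_module_iso_of_common_presentation:
  fixes \<alpha> :: "'y \<Rightarrow> 'b" and \<beta> :: "'y \<Rightarrow> 'c"
  assumes carrier: "carrier N = range \<alpha>" "carrier N' = range \<beta>"
    and fibres: "\<And>x y. \<alpha> x = \<alpha> y \<longleftrightarrow> \<beta> x = \<beta> y"
    and add: "\<And>x y. \<exists>z. \<alpha> z = \<alpha> x \<oplus>\<^bsub>N\<^esub> \<alpha> y \<and> \<beta> z = \<beta> x \<oplus>\<^bsub>N'\<^esub> \<beta> y"
    and smult: "\<And>a x. a \<in> carrier R \<Longrightarrow> \<exists>z. \<alpha> z = a \<odot>\<^bsub>N\<^esub> \<alpha> x \<and> \<beta> z = a \<odot>\<^bsub>N'\<^esub> \<beta> x"
    and component: "\<And>n. \<exists>Z. component N n = \<alpha> ` Z \<and> component N' n = \<beta> ` Z"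
  shows "\<exists>\<phi>. graded_module_iso R N N' \<phi>"
proof -
  define \<phi> where "\<phi> u = \<beta> (SOME y. \<alpha> y = u)" for u
  have \<phi>: "\<phi> (\<alpha> y) = \<beta> y" for y
  proof -
    have "\<alpha> (SOME x. \<alpha> x = \<alpha> y) = \<alpha> y" by (rule someI[of "\<lambda>x. \<alpha> x = \<alpha> y"]) simp
    then show ?thesis by (simp add: \<phi>_def fibres)
  qed
  have "bij_betw \<phi> (range \<alpha>) (range \<beta>)"
    by (auto simp: bij_betw_def inj_on_def \<phi> fibres image_iff)
  moreover have "\<phi> (\<alpha> x \<oplus>\<^bsub>N\<^esub> \<alpha> y) = \<beta> x \<oplus>\<^bsub>N'\<^esub> \<beta> y" for x y using add[of x y] \<phi> by metis
  moreover have "\<phi> (a \<odot>\<^bsub>N\<^esub> \<alpha> x) = a \<odot>\<^bsub>N'\<^esub> \<beta> x" if "a \<in> carrier R" for a x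
    using smult[OF that, of x] \<phi> by metis
  moreover have "\<phi> ` component N n = component N' n" for n
    using component[of n] by (auto simp: image_image \<phi>)
  ultimately have "graded_module_iso R N N' \<phi>"
    by (auto simp: graded_module_iso_def carrier \<phi>)
  then show ?thesis by (rule exI[of "graded_module_iso R N N'" \<phi>])
qed

lemma shift_simps [simp]:
  "carrier (shift N k) = carrier N"
  "x \<oplus>\<^bsub>shift N k\<^esub> y = x \<oplus>\<^bsub>N\<^esub> y"
  "a \<odot>\<^bsub>shift N k\<^esub> x = a \<odot>\<^bsub>N\<^esub> x"
  "component (shift N k) n = component N (n + k)"
  by (simp_all add: shift_def)

lemma direct_sum2_simps [simp]:
  "carrier (direct_sum2 N N') = carrier N \<times> carrier N'"
  "(x, x') \<oplus>\<^bsub>direct_sum2 N N'\<^esub> (y, y') = (x \<oplus>\<^bsub>N\<^esub> y, x' \<oplus>\<^bsub>N'\<^esub> y')"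
  "a \<odot>\<^bsub>direct_sum2 N N'\<^esub> (x, x') = (a \<odot>\<^bsub>N\<^esub> x, a \<odot>\<^bsub>N'\<^esub> x')"
  "component (direct_sum2 N N') n = component N n \<times> component N' n"
  by (simp_all add: direct_sum2_def)

lemma direct_sum_simps [simp]:
  "carrier (direct_sum I N) = (\<Pi>\<^sub>E i\<in>I. carrier (N i))"
  "f \<oplus>\<^bsub>direct_sum I N\<^esub> g = (\<lambda>i\<in>I. f i \<oplus>\<^bsub>N i\<^esub> g i)"
  "a \<odot>\<^bsub>direct_sum I N\<^esub> f = (\<lambda>i\<in>I. a \<odot>\<^bsub>N i\<^esub> f i)"
  "component (direct_sum I N) n = (\<Pi>\<^sub>E i\<in>I. component (N i) n)"
  by (simp_all add: direct_sum_def)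

context apery_table
begin

abbreviation decomposition where
  "decomposition \<equiv> direct_sum2 FM (direct_sum {1..e - 1} (\<lambda>i. direct_sum2 (shift FM (- int (d i)))
     (direct_sum {1..l i} (\<lambda>j. shift (quotient (c i j)) (- int (b i j))))))"

text \<open>The counterpart of \<open>tangent_class\<close> for the direct sum: the same polynomials, taken modulo
  \<open>T\<close> to the power \<open>c i j\<close> for the bounded runs.\<close>

definition summand_classes ::
  "(nat \<times> nat \<Rightarrow> 'k poly) \<Rightarrow> (nat \<Rightarrow> 'k fps set) \<times> (nat \<Rightarrow> (nat \<Rightarrow> 'k fps set) \<times> (nat \<Rightarrow> (nat \<Rightarrow> 'k fps set) set))"
  where "summand_classes y = (fiber_class (y (0, 0)), \<lambda>i\<in>{1..e - 1}.
     (fiber_class (y (i, 0)), \<lambda>j\<in>{1..l i}. truncation_class (c i j) (y (i, j))))"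

lemma restrict_eq_iff: "restrict f I = restrict g I \<longleftrightarrow> (\<forall>i\<in>I. f i = g i)"
  by (auto simp: restrict_def fun_eq_iff)

lemma summand_classes_eq_iff:
  "summand_classes x = summand_classes y
    \<longleftrightarrow> (\<forall>\<gamma>\<in>\<Gamma>. \<forall>n. live \<gamma> n \<longrightarrow> coeff (x \<gamma>) (n - deg \<gamma>) = coeff (y \<gamma>) (n - deg \<gamma>))"
proof -
  \<comment> \<open>A run of infinite length sees all coefficients, a run of length \<open>a\<close> the first \<open>a\<close> of them.\<close>
  have free: "p = q \<longleftrightarrow> (\<forall>n. m \<le> n \<longrightarrow> coeff p (n - m) = coeff q (n - m))" for p q :: "'k poly" and m
    unfolding poly_eq_iff by (metis add_diff_cancel_right' le_add2)
  have torsion: "(\<forall>k<a. coeff p k = coeff q k)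
      \<longleftrightarrow> (\<forall>n. m \<le> n \<and> n < m + a \<longrightarrow> coeff p (n - m) = coeff q (n - m))" for p q :: "'k poly" and m a
    by (metis add_diff_cancel_left' le_add1 le_add_diff_inverse nat_add_left_cancel_less)
  have "(\<forall>\<gamma>\<in>\<Gamma>. \<forall>n. live \<gamma> n \<longrightarrow> coeff (x \<gamma>) (n - deg \<gamma>) = coeff (y \<gamma>) (n - deg \<gamma>))
    \<longleftrightarrow> x (0, 0) = y (0, 0) \<and> (\<forall>i\<in>{1..e - 1}. x (i, 0) = y (i, 0) \<and>
      (\<forall>j\<in>{1..l i}. \<forall>k<c i j. coeff (x (i, j)) k = coeff (y (i, j)) k))"
  proof -
    let ?P = "\<lambda>\<gamma>. \<forall>n. live \<gamma> n \<longrightarrow> coeff (x \<gamma>) (n - deg \<gamma>) = coeff (y \<gamma>) (n - deg \<gamma>)"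
    have split: "(\<forall>\<gamma>\<in>\<Gamma>. ?P \<gamma>) \<longleftrightarrow> ?P (0, 0) \<and> (\<forall>i\<in>{1..e - 1}. ?P (i, 0) \<and> (\<forall>j\<in>{1..l i}. ?P (i, j)))"
    proof -
      have "{..l i} = insert 0 {1..l i}" for i by auto
      then show ?thesis by (simp only: \<Gamma>_def ball_simps Sigma_def UN_iff) blast
    qed
    have "?P (i, 0) \<longleftrightarrow> x (i, 0) = y (i, 0)" for i
      using free[of "x (i, 0)" "y (i, 0)" "deg (i, 0)"] by (simp add: live_def)
    moreover have "?P (i, j) \<longleftrightarrow> (\<forall>k<c i j. coeff (x (i, j)) k = coeff (y (i, j)) k)"
      if "i \<in> {1..e - 1}" "j \<in> {1..l i}" for i j
      using torsion[of "c i j" "x (i, j)" "y (i, j)" "deg (i, j)"] that by (simp add: live_def)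
    ultimately show ?thesis unfolding split by simp
  qed
  then show ?thesis
    by (simp add: summand_classes_def restrict_eq_iff truncation_class_eq_iff)
qed

text \<open>The components \<open>y \<gamma>\<close> can be chosen independently. The lemma gives the carrier for \<open>H \<gamma> = UNIV\<close> and
  the homogeneous components when \<open>H \<gamma>\<close> consists of homogeneous polynomials.\<close>

lemma summand_classes_image:
  "summand_classes ` {y. \<forall>\<gamma>\<in>\<Gamma>. y \<gamma> \<in> H \<gamma>} = fiber_class ` H (0, 0) \<times>
    (\<Pi>\<^sub>E i\<in>{1..e - 1}. fiber_class ` H (i, 0) \<times> (\<Pi>\<^sub>E j\<in>{1..l i}. truncation_class (c i j) ` H (i, j)))"
  (is "?L = ?R")
proof (intro equalityI subsetI)
  fix f assume "f \<in> ?L"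
  then obtain y where f: "f = summand_classes y" and y: "\<And>\<gamma>. \<gamma> \<in> \<Gamma> \<Longrightarrow> y \<gamma> \<in> H \<gamma>" by blast
  have "y (0, 0) \<in> H (0, 0)" by (rule y) (simp add: \<Gamma>_def)
  moreover have "y (i, j) \<in> H (i, j)" if "i \<in> {1..e - 1}" "j \<le> l i" for i j
    using that by (intro y) (simp add: \<Gamma>_def)
  ultimately show "f \<in> ?R"
    unfolding f summand_classes_def by (intro SigmaI PiE_I) auto
next
  fix f assume "f \<in> ?R"
  then obtain u g where f: "f = (u, g)" and u: "u \<in> fiber_class ` H (0, 0)"
    and g: "g \<in> (\<Pi>\<^sub>E i\<in>{1..e - 1}. fiber_class ` H (i, 0) \<times>
      (\<Pi>\<^sub>E j\<in>{1..l i}. truncation_class (c i j) ` H (i, j)))" by blast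
  obtain p where p: "p \<in> H (0, 0)" "u = fiber_class p" using u by blast
  have "\<forall>i. \<exists>q. i \<in> {1..e - 1} \<longrightarrow> q \<in> H (i, 0) \<and> fst (g i) = fiber_class q"
  proof
    fix i show "\<exists>q. i \<in> {1..e - 1} \<longrightarrow> q \<in> H (i, 0) \<and> fst (g i) = fiber_class q"
      using PiE_mem[OF g, of i] by (cases "g i") auto
  qed
  then obtain q where q: "\<And>i. i \<in> {1..e - 1} \<Longrightarrow> q i \<in> H (i, 0) \<and> fst (g i) = fiber_class (q i)" by metis
  have "\<forall>i j. \<exists>s. i \<in> {1..e - 1} \<longrightarrow> j \<in> {1..l i} \<longrightarrow> s \<in> H (i, j) \<and> snd (g i) j = truncation_class (c i j) s"
  proof (intro allI)
    fix i j show "\<exists>s. i \<in> {1..e - 1} \<longrightarrow> j \<in> {1..l i} \<longrightarrow> s \<in> H (i, j) \<and> snd (g i) j = truncation_class (c i j) s"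
    proof (cases "i \<in> {1..e - 1} \<and> j \<in> {1..l i}")
      case True
      then have "snd (g i) \<in> (\<Pi>\<^sub>E j\<in>{1..l i}. truncation_class (c i j) ` H (i, j))"
        using PiE_mem[OF g, of i] by (cases "g i") auto
      then have "snd (g i) j \<in> truncation_class (c i j) ` H (i, j)" by (rule PiE_mem) (use True in blast)
      then show ?thesis by blast
    qed blast
  qed
  then obtain s where s: "\<And>i j. i \<in> {1..e - 1} \<Longrightarrow> j \<in> {1..l i} \<Longrightarrow>
      s i j \<in> H (i, j) \<and> snd (g i) j = truncation_class (c i j) (s i j)" by metis
  define y where "y = (\<lambda>(i, j). if i = 0 then p else if j = 0 then q i else s i j)"
  have "y \<gamma> \<in> H \<gamma>" if "\<gamma> \<in> \<Gamma>" for \<gamma>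
    using that
  proof (cases rule: \<Gamma>_cases)
    case (2 i j)
    then show ?thesis using q[of i] s[of i j] by (cases "j = 0") (auto simp: y_def)
  qed (use p in \<open>simp add: y_def\<close>)
  moreover have "f = summand_classes y"
  proof -
    have snd: "snd (g i) = (\<lambda>j\<in>{1..l i}. truncation_class (c i j) (s i j))" if i: "i \<in> {1..e - 1}" for i
    proof (rule extensionalityI[where A = "{1..l i}"])
      show "snd (g i) \<in> extensional {1..l i}"
        using PiE_mem[OF g i] by (auto simp: PiE_def)
    qed (use s[OF i] in auto)
    have "g = (\<lambda>i\<in>{1..e - 1}. (fiber_class (q i), \<lambda>j\<in>{1..l i}. truncation_class (c i j) (s i j)))"
    proof (rule extensionalityI[where A = "{1..e - 1}"])
      show "g \<in> extensional {1..e - 1}" using g by (simp add: PiE_def)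
      show "g i = (\<lambda>i\<in>{1..e - 1}. (fiber_class (q i), \<lambda>j\<in>{1..l i}. truncation_class (c i j) (s i j))) i"
        if "i \<in> {1..e - 1}" for i
        using q[OF that] snd[OF that] that by (simp add: prod_eq_iff)
    qed simp
    also have "\<dots> = (\<lambda>i\<in>{1..e - 1}. (fiber_class (y (i, 0)), \<lambda>j\<in>{1..l i}. truncation_class (c i j) (y (i, j))))"
      by (auto simp: y_def intro!: restrict_ext)
    finally show ?thesis unfolding f summand_classes_def p(2) by (simp add: y_def)
  qed
  ultimately show "f \<in> ?L" by blast
qed

lemma carrier_decomposition: "carrier decomposition = range summand_classes"
  using summand_classes_image[of "\<lambda>_. UNIV"] by (simp add: carrier_F carrier_quotient)

lemma component_decomposition:
  "component decomposition n
    = summand_classes ` {y. \<forall>\<gamma>\<in>\<Gamma>. homogeneous_poly (n - int (deg \<gamma>)) (y \<gamma>)}"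
proof -
  have "component decomposition n = fiber_class ` {p. homogeneous_poly (n - int (deg (0, 0))) p} \<times>
    (\<Pi>\<^sub>E i\<in>{1..e - 1}. fiber_class ` {p. homogeneous_poly (n - int (deg (i, 0))) p} \<times>
      (\<Pi>\<^sub>E j\<in>{1..l i}. truncation_class (c i j) ` {p. homogeneous_poly (n - int (deg (i, j))) p}))"
    unfolding direct_sum2_simps direct_sum_simps shift_simps component_FM component_quotient
    by (intro arg_cong2[where f = "(\<times>)"] PiE_cong) (auto simp: deg_def)
  then show ?thesis
    using summand_classes_image[of "\<lambda>\<gamma>. {p. homogeneous_poly (n - int (deg \<gamma>)) p}"] by simp
qed

lemma add_decomposition:
  "summand_classes x \<oplus>\<^bsub>decomposition\<^esub> summand_classes y = summand_classes (\<lambda>\<gamma>. x \<gamma> + y \<gamma>)"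
  by (auto simp: summand_classes_def add_F add_quotient intro!: restrict_ext)

lemma smult_decomposition:
  "fiber_class p \<odot>\<^bsub>decomposition\<^esub> summand_classes y = summand_classes (\<lambda>\<gamma>. p * y \<gamma>)"
  by (auto simp: summand_classes_def mult_F smult_quotient intro!: restrict_ext)

theorem tangent_cone_decomposition: "\<exists>\<phi>. graded_module_iso F GM decomposition \<phi>"
proof (rule graded_module_iso_of_common_presentation[where \<alpha> = tangent_class and \<beta> = summand_classes])
  show "\<exists>z. tangent_class z = a \<odot>\<^bsub>GM\<^esub> tangent_class x
      \<and> summand_classes z = a \<odot>\<^bsub>decomposition\<^esub> summand_classes x" if a: "a \<in> carrier F" for a x
  proof -
    obtain p where p: "a = fiber_class p" using a unfolding carrier_F by blast
    show ?thesis unfolding p smult_GM smult_decomposition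
      by (rule exI[of _ "\<lambda>\<gamma>. p * x \<gamma>"]) simp
  qed
  show "\<exists>z. tangent_class z = tangent_class x \<oplus>\<^bsub>GM\<^esub> tangent_class y
      \<and> summand_classes z = summand_classes x \<oplus>\<^bsub>decomposition\<^esub> summand_classes y" for x y
    unfolding add_GM add_decomposition by (rule exI[of _ "\<lambda>\<gamma>. x \<gamma> + y \<gamma>"]) simp
  show "\<exists>Z. component GM n = tangent_class ` Z \<and> component decomposition n = summand_classes ` Z" for n
    unfolding component_GM component_decomposition
    by (rule exI[of _ "{y. \<forall>\<gamma>\<in>\<Gamma>. homogeneous_poly (n - int (deg \<gamma>)) (y \<gamma>)}"]) simp
qed (simp_all only: carrier_GM carrier_decomposition tangent_class_eq_tangent_class_iff summand_classes_eq_iff)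

end

theorem theorem2p3:
  fixes S :: "nat set" and e r :: nat
    and A :: "'k::field fps ring" and \<mm> :: "'k fps set"
    and \<omega> :: "nat \<Rightarrow> nat \<Rightarrow> nat" and W :: "nat \<Rightarrow> int list"
    and l d :: "nat \<Rightarrow> nat" and b c :: "nat \<Rightarrow> nat \<Rightarrow> nat"
    and F :: "(nat \<Rightarrow> 'k fps set) ring" and tstar :: "nat \<Rightarrow> 'k fps set"
    and FM GM :: "(nat \<Rightarrow> 'k fps set, nat \<Rightarrow> 'k fps set) graded_module"
  assumes "numerical_semigroup S"
    and "e = semigroup_multiplicity S"
    and "A = semigroup_ring S"
    and "maximalideal \<mm> A"
    and "r = reduction_number A \<mm> (fps_X ^ e)"
    and "\<forall>n\<le>r. Apery e (multiple_of_max S n) = \<omega> n ` {0..e - 1}"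
    and "\<forall>i\<le>e - 1. \<forall>n\<le>r. \<forall>n'\<le>r. \<omega> n i mod e = \<omega> n' i mod e"
    and "\<forall>n\<le>r. \<omega> n 0 = n * e"
    and "\<forall>i\<in>{1..e - 1}. W i = map (\<lambda>n. int (\<omega> n i)) [0..<Suc r]"
    and "\<forall>i\<in>{1..e - 1}. l i = ladder_l (W i)"
    and "\<forall>i\<in>{1..e - 1}. d i = ladder_e (W i) (l i)"
    and "\<forall>i\<in>{1..e - 1}. \<forall>j\<in>{1..l i}. b i j = ladder_e (W i) (j - 1)"
    and "\<forall>i\<in>{1..e - 1}. \<forall>j\<in>{1..l i}. c i j = ladder_c (W i) j"
    and "F = fiber_cone A \<mm> (fps_X ^ e)"
    and "FM = fiber_cone_module A \<mm> (fps_X ^ e)"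
    and "GM = tangent_cone_module A \<mm>"
    and "tstar = initial_form A \<mm> (fps_X ^ e)"
  shows "\<exists>\<phi>. graded_module_iso F GM
    (direct_sum2 FM
      (direct_sum {1..e - 1} (\<lambda>i.
        direct_sum2
          (shift FM (- int (d i)))
          (direct_sum {1..l i} (\<lambda>j.
            shift (quotient_module FM (PIdl\<^bsub>F\<^esub> (tstar [^]\<^bsub>F\<^esub> c i j))) (- int (b i j)))))))
    \<phi>"
proof -
  have semigroup: "semigroup_of_multiplicity S e"
    using assms(1,2) by (rule semigroup_of_multiplicity.intro)
  then have ring: "semigroup_ring_over S e" by (rule semigroup_ring_over.intro)
  have A: "A = concrete_ring (supported S)" unfolding assms(3) by (rule semigroup_ring_eq)
  have \<mm>: "\<mm> = supported (S - {0})"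
    by (rule semigroup_of_multiplicity.maximal_ideal_eq[OF semigroup assms(4)[unfolded A]])
  have "apery_table TYPE('k) S e r \<omega> W l d b c"
  proof (rule apery_table.intro[OF ring], unfold apery_table_axioms_def, intro conjI)
    show "r = reduction_number (concrete_ring (supported S) :: 'k fps ring) (supported (S - {0})) (fps_X ^ e)"
      using assms(5) unfolding A \<mm> .
  qed ((use assms(6) in blast), (use assms(7) in blast), (use assms(8) in blast),
       (use assms(9) in blast), (use assms(10) in blast), (use assms(11) in blast),
       (use assms(12) in blast), (use assms(13) in blast))
  from apery_table.tangent_cone_decomposition[OF this] show ?thesis
    unfolding assms(14-17) A \<mm> semigroup_ring_over.PIdl_eq[OF ring] .
qed

end
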